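(* For every holomorphic map $\varphi:\mathbb H\to\mathbb H$ such that the composition operator $C_\varphi$ is bounded on $H^2(\mathbb H)$, we have $\|C_\varphi\|=\|C_\varphi\|_e$. In particular, there are no nonzero compact composition operators on $H^2(\mathbb H)$.
   Context: $\mathbb H=\{z\in\mathbb C:\Re z>0\}$ is the open right half-plane. $H^2(\mathbb H)$ is the Hilbert space of holomorphic functions $f$ on $\mathbb H$ with $\|f\|^2=\sup_{x>0}\frac{1}{2\pi}\int_{-\infty}^{\infty}|f(x+iy)|^2\,dy<\infty$. For a holomorphic map $\varphi:\mathbb H\to\mathbb H$, the composition operator is $C_\varphi f=f\circ\varphi$; it is bounded on $H^2(\mathbb H)$ if it maps $H^2(\mathbb H)$ into itself and is a bounded operator there, and $\|C_\varphi\|$ is its operator norm. For a bounded operator $T$ on a Hilbert space $H$, the essential norm $\|T\|_e$ is the distance, in operator norm, from $T$ to the set of compact operators on $H$. *)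

theory Defs
  imports "HOL-Complex_Analysis.Complex_Analysis"
begin

section \<open>The Hardy space of the right half-plane\<close>

definition half_plane :: "complex set" where
  "half_plane = {z. Re z > 0}"

definition H2_norm_sq :: "(complex \<Rightarrow> complex) \<Rightarrow> ennreal" where
  "H2_norm_sq f = (SUP x\<in>{0<..}.
     ennreal (1 / (2 * pi)) * (\<integral>\<^sup>+ y. ennreal ((cmod (f (Complex x y)))\<^sup>2) \<partial>lborel))"

text \<open>
  Functions on the half-plane are represented by total functions that vanish off the half-plane,
  so that equality of elements is equality on the half-plane.
\<close>

definition H2_set :: "(complex \<Rightarrow> complex) set" where
  "H2_set = {f. f holomorphic_on half_plane \<and> (\<forall>z. z \<notin> half_plane \<longrightarrow> f z = 0) \<and> H2_norm_sq f < \<infinity>}"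

lemma slice_measurable:
  assumes "f holomorphic_on half_plane" "x > 0"
  shows "continuous_on UNIV (\<lambda>y. f (Complex x y))"
    and "(\<lambda>y. f (Complex x y)) \<in> borel_measurable lborel"
proof -
  have "continuous_on half_plane f"
    using assms(1) by (rule holomorphic_on_imp_continuous_on)
  moreover have "continuous_on UNIV (Complex x)"
    unfolding Complex_eq by (intro continuous_intros)
  moreover have "range (Complex x) \<subseteq> half_plane"
    using assms(2) by (auto simp: half_plane_def)
  ultimately show c: "continuous_on UNIV (\<lambda>y. f (Complex x y))"
    using continuous_on_compose2 by blast
  show "(\<lambda>y. f (Complex x y)) \<in> borel_measurable lborel"
    using borel_measurable_continuous_onI[OF c] by simp
qed

lemma H2_norm_sq_zero: "H2_norm_sq (\<lambda>z. 0) = 0"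
  by (simp add: H2_norm_sq_def)

lemma H2_norm_sq_cmult:
  assumes "f holomorphic_on half_plane"
  shows "H2_norm_sq (\<lambda>z. c * f z) = ennreal ((cmod c)\<^sup>2) * H2_norm_sq f"
proof -
  have "(\<integral>\<^sup>+ y. ennreal ((cmod (c * f (Complex x y)))\<^sup>2) \<partial>lborel)
      = ennreal ((cmod c)\<^sup>2) * (\<integral>\<^sup>+ y. ennreal ((cmod (f (Complex x y)))\<^sup>2) \<partial>lborel)"
    if "x > 0" for x
  proof -
    note [measurable] = slice_measurable(2)[OF assms that]
    show ?thesis
      by (subst nn_integral_cmult[symmetric])
         (auto simp: norm_mult power_mult_distrib ennreal_mult')
  qed
  then have "H2_norm_sq (\<lambda>z. c * f z) = (SUP x\<in>{0<..}. ennreal ((cmod c)\<^sup>2) *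
     (ennreal (1 / (2 * pi)) * (\<integral>\<^sup>+ y. ennreal ((cmod (f (Complex x y)))\<^sup>2) \<partial>lborel)))"
    unfolding H2_norm_sq_def by (intro SUP_cong) (auto simp: mult_ac)
  then show ?thesis
    unfolding H2_norm_sq_def by (subst SUP_mult_left_ennreal) auto
qed

lemma norm_add_sq_le:
  fixes u v :: complex
  assumes "a > 0" "b > 0"
  shows "(cmod (u + v))\<^sup>2 \<le> (a + b) / a * (cmod u)\<^sup>2 + (a + b) / b * (cmod v)\<^sup>2"
proof -
  have "(cmod (u + v))\<^sup>2 \<le> (cmod u + cmod v)\<^sup>2"
    by (intro power_mono norm_triangle_ineq) auto
  also have "\<dots> \<le> (cmod u + cmod v)\<^sup>2 + (b * cmod u - a * cmod v)\<^sup>2 / (a * b)"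
    using assms by simp
  also have "\<dots> = (a + b) / a * (cmod u)\<^sup>2 + (a + b) / b * (cmod v)\<^sup>2"
    using assms by (simp add: field_simps power2_eq_square)
  finally show ?thesis .
qed

lemma H2_norm_sq_add:
  assumes f: "f holomorphic_on half_plane" and g: "g holomorphic_on half_plane"
    and a: "a > 0" "H2_norm_sq f \<le> ennreal (a\<^sup>2)" and b: "b > 0" "H2_norm_sq g \<le> ennreal (b\<^sup>2)"
  shows "H2_norm_sq (\<lambda>z. f z + g z) \<le> ennreal ((a + b)\<^sup>2)"
  unfolding H2_norm_sq_def
proof (rule SUP_least)
  fix x :: real assume "x \<in> {0<..}"
  then have x: "x > 0" by simp
  note [measurable] = slice_measurable(2)[OF f x] slice_measurable(2)[OF g x]
  let ?k = "ennreal (1 / (2 * pi))"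
  let ?F = "\<integral>\<^sup>+ y. ennreal ((cmod (f (Complex x y)))\<^sup>2) \<partial>lborel"
  let ?G = "\<integral>\<^sup>+ y. ennreal ((cmod (g (Complex x y)))\<^sup>2) \<partial>lborel"
  have F: "?k * ?F \<le> ennreal (a\<^sup>2)"
    using a(2) x unfolding H2_norm_sq_def by (auto simp: SUP_le_iff)
  have G: "?k * ?G \<le> ennreal (b\<^sup>2)"
    using b(2) x unfolding H2_norm_sq_def by (auto simp: SUP_le_iff)
  have "(\<integral>\<^sup>+ y. ennreal ((cmod (f (Complex x y) + g (Complex x y)))\<^sup>2) \<partial>lborel)
     \<le> (\<integral>\<^sup>+ y. ennreal ((a + b) / a) * ennreal ((cmod (f (Complex x y)))\<^sup>2)
            + ennreal ((a + b) / b) * ennreal ((cmod (g (Complex x y)))\<^sup>2) \<partial>lborel)"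
    using a(1) b(1)
    by (intro nn_integral_mono)
       (simp add: norm_add_sq_le ennreal_mult[symmetric] ennreal_plus[symmetric]
          del: ennreal_plus times_divide_eq_left)
  also have "\<dots> = ennreal ((a + b) / a) * ?F + ennreal ((a + b) / b) * ?G"
    by (subst nn_integral_add) (auto simp: nn_integral_cmult)
  finally have "?k * (\<integral>\<^sup>+ y. ennreal ((cmod (f (Complex x y) + g (Complex x y)))\<^sup>2) \<partial>lborel)
     \<le> ?k * (ennreal ((a + b) / a) * ?F + ennreal ((a + b) / b) * ?G)"
    by (intro mult_left_mono) auto
  also have "\<dots> = ennreal ((a + b) / a) * (?k * ?F) + ennreal ((a + b) / b) * (?k * ?G)"
    by (simp add: algebra_simps)
  also have "\<dots> \<le> ennreal ((a + b) / a) * ennreal (a\<^sup>2) + ennreal ((a + b) / b) * ennreal (b\<^sup>2)"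
    using F G by (intro add_mono mult_left_mono) auto
  also have "\<dots> = ennreal ((a + b) / a * a\<^sup>2 + (a + b) / b * b\<^sup>2)"
    using a(1) b(1) by (simp add: ennreal_mult[symmetric] ennreal_plus[symmetric] del: ennreal_plus)
  also have "(a + b) / a * a\<^sup>2 + (a + b) / b * b\<^sup>2 = (a + b)\<^sup>2"
    using a(1) b(1) by (simp add: field_simps power2_eq_square)
  finally show "?k * (\<integral>\<^sup>+ y. ennreal ((cmod (f (Complex x y) + g (Complex x y)))\<^sup>2) \<partial>lborel)
      \<le> ennreal ((a + b)\<^sup>2)" .
qed

lemma H2_norm_sq_le:
  assumes "H2_norm_sq f < \<infinity>" "e \<ge> 0"
  shows "H2_norm_sq f \<le> ennreal ((sqrt (enn2real (H2_norm_sq f)) + e)\<^sup>2)"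
proof -
  have "H2_norm_sq f = ennreal (enn2real (H2_norm_sq f))"
    using assms by simp
  also have "\<dots> = ennreal ((sqrt (enn2real (H2_norm_sq f)))\<^sup>2)"
    by simp
  also have "\<dots> \<le> ennreal ((sqrt (enn2real (H2_norm_sq f)) + e)\<^sup>2)"
    using assms(2) by (intro ennreal_leI power_mono) auto
  finally show ?thesis .
qed

lemma H2_norm_sq_eq_0_imp:
  assumes f: "f holomorphic_on half_plane" and "H2_norm_sq f = 0" "z \<in> half_plane"
  shows "f z = 0"
proof (rule ccontr)
  assume nz: "f z \<noteq> 0"
  define h where "h = (\<lambda>y. f (Complex (Re z) y))"
  have x: "Re z > 0" using assms(3) by (simp add: half_plane_def)
  note c = slice_measurable(1)[OF f x, folded h_def]
  note m [measurable] = slice_measurable(2)[OF f x, folded h_def]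
  have "ennreal (1 / (2 * pi)) * (\<integral>\<^sup>+ y. ennreal ((cmod (h y))\<^sup>2) \<partial>lborel) \<le> H2_norm_sq f"
    unfolding H2_norm_sq_def h_def using x by (intro SUP_upper) auto
  then have "(\<integral>\<^sup>+ y. ennreal ((cmod (h y))\<^sup>2) \<partial>lborel) = 0"
    using assms(2) pi_gt_zero by (auto simp: ennreal_eq_0_iff simp del: pi_gt_zero)
  then have ae: "AE y in lborel. h y = 0"
    by (subst (asm) nn_integral_0_iff_AE) (auto simp: ennreal_eq_0_iff)
  let ?U = "{y. h y \<noteq> 0}"
  have op: "open ?U"
  proof -
    have "open (h -` (- {0}))"
      using c by (intro open_vimage) auto
    then show ?thesis by (simp add: vimage_def)
  qed
  have "?U \<in> null_sets lborel"
    using ae AE_iff_null_sets[of ?U lborel] op by auto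
  then have "negligible ?U"
    by (simp add: negligible_iff_null_sets null_sets_completionI)
  moreover have "Im z \<in> ?U" using nz by (simp add: h_def)
  ultimately show False using open_not_negligible[OF op] by auto
qed

lemma H2_set_zero: "(\<lambda>z. 0) \<in> H2_set"
  by (simp add: H2_set_def H2_norm_sq_zero)

lemma H2_set_cmult: "f \<in> H2_set \<Longrightarrow> (\<lambda>z. c * f z) \<in> H2_set"
  by (auto simp: H2_set_def H2_norm_sq_cmult ennreal_mult_less_top intro!: holomorphic_intros)

lemma H2_set_add:
  assumes "f \<in> H2_set" "g \<in> H2_set"
  shows "(\<lambda>z. f z + g z) \<in> H2_set"
proof -
  let ?a = "sqrt (enn2real (H2_norm_sq f)) + 1" and ?b = "sqrt (enn2real (H2_norm_sq g)) + 1"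
  have "H2_norm_sq (\<lambda>z. f z + g z) \<le> ennreal ((?a + ?b)\<^sup>2)"
    using assms by (intro H2_norm_sq_add H2_norm_sq_le) (auto simp: H2_set_def add_nonneg_pos)
  also have "\<dots> < \<infinity>" by simp
  finally show ?thesis
    using assms by (auto simp: H2_set_def intro!: holomorphic_intros)
qed

typedef H2 = H2_set
  using H2_set_zero by blast

setup_lifting type_definition_H2

text \<open>The library has no class of complex vector spaces, so the complex scalar action is
  declared separately from the real one in the instance below.\<close>

lift_definition scaleC_H2 :: "complex \<Rightarrow> H2 \<Rightarrow> H2" is "\<lambda>c f z. c * f z"
  by (rule H2_set_cmult)

instantiation H2 :: real_vector
begin

lift_definition zero_H2 :: H2 is "\<lambda>z. 0" by (rule H2_set_zero)

lift_definition plus_H2 :: "H2 \<Rightarrow> H2 \<Rightarrow> H2" is "\<lambda>f g z. f z + g z" by (rule H2_set_add)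

lift_definition uminus_H2 :: "H2 \<Rightarrow> H2" is "\<lambda>f z. - f z"
  using H2_set_cmult[of _ "-1"] by simp

lift_definition minus_H2 :: "H2 \<Rightarrow> H2 \<Rightarrow> H2" is "\<lambda>f g z. f z - g z"
  using H2_set_add[OF _ H2_set_cmult[of _ "-1"]] by simp

lift_definition scaleR_H2 :: "real \<Rightarrow> H2 \<Rightarrow> H2" is "\<lambda>r f z. complex_of_real r * f z"
  by (rule H2_set_cmult)

instance
proof
  fix f g h :: H2 and a b :: real
  show "f + g + h = f + (g + h)" by transfer (simp add: add_ac)
  show "f + g = g + f" by transfer (simp add: add_ac)
  show "0 + f = f" by transfer simp
  show "- f + f = 0" by transfer simp
  show "f - g = f + - g" by transfer simp
  show "a *\<^sub>R (f + g) = a *\<^sub>R f + a *\<^sub>R g" by transfer (simp add: algebra_simps)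
  show "(a + b) *\<^sub>R f = a *\<^sub>R f + b *\<^sub>R f" by transfer (simp add: algebra_simps)
  show "a *\<^sub>R b *\<^sub>R f = (a * b) *\<^sub>R f" by transfer (simp add: algebra_simps)
  show "1 *\<^sub>R f = f" by transfer simp
qed

end

instantiation H2 :: real_normed_vector
begin

lift_definition norm_H2 :: "H2 \<Rightarrow> real" is "\<lambda>f. sqrt (enn2real (H2_norm_sq f))" .

definition "dist_H2 (f :: H2) g = norm (f - g)"
definition "sgn_H2 (f :: H2) = f /\<^sub>R norm f"
definition [code del]: "(uniformity :: (H2 \<times> H2) filter) = (INF e\<in>{0<..}. principal {(f, g). dist f g < e})"
definition [code del]: "open (U :: H2 set) \<longleftrightarrow>
  (\<forall>f\<in>U. eventually (\<lambda>(f', g). f' = f \<longrightarrow> g \<in> U) uniformity)"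

instance
proof
  fix f g :: H2 and a :: real and U :: "H2 set"
  show "dist f g = norm (f - g)" by (rule dist_H2_def)
  show "sgn f = f /\<^sub>R norm f" by (rule sgn_H2_def)
  show "uniformity = (INF e\<in>{0<..}. principal {(f :: H2, g). dist f g < e})"
    by (rule uniformity_H2_def)
  show "open U \<longleftrightarrow> (\<forall>f\<in>U. eventually (\<lambda>(f', g). f' = f \<longrightarrow> g \<in> U) uniformity)"
    by (rule open_H2_def)
  show "norm f = 0 \<longleftrightarrow> f = 0"
  proof transfer
    fix f assume f: "f \<in> H2_set"
    show "sqrt (enn2real (H2_norm_sq f)) = 0 \<longleftrightarrow> f = (\<lambda>z. 0)"
    proof
      assume "sqrt (enn2real (H2_norm_sq f)) = 0"
      then have "H2_norm_sq f = 0"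
        using f by (auto simp: H2_set_def enn2real_eq_0_iff)
      then show "f = (\<lambda>z. 0)"
        using f H2_norm_sq_eq_0_imp[of f] by (auto simp: H2_set_def fun_eq_iff)
    qed (simp add: H2_norm_sq_zero)
  qed
  show "norm (f + g) \<le> norm f + norm g"
  proof transfer
    fix f g assume fg: "f \<in> H2_set" "g \<in> H2_set"
    show "sqrt (enn2real (H2_norm_sq (\<lambda>z. f z + g z)))
      \<le> sqrt (enn2real (H2_norm_sq f)) + sqrt (enn2real (H2_norm_sq g))"
    proof (rule field_le_epsilon)
      fix e :: real assume e: "e > 0"
      let ?a = "sqrt (enn2real (H2_norm_sq f)) + e / 2"
        and ?b = "sqrt (enn2real (H2_norm_sq g)) + e / 2"
      have pos: "?a > 0" "?b > 0" using e by (auto simp: add_nonneg_pos)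
      have "H2_norm_sq (\<lambda>z. f z + g z) \<le> ennreal ((?a + ?b)\<^sup>2)"
        using fg e pos by (intro H2_norm_sq_add H2_norm_sq_le) (auto simp: H2_set_def)
      then have "enn2real (H2_norm_sq (\<lambda>z. f z + g z)) \<le> (?a + ?b)\<^sup>2"
        by (intro enn2real_leI) auto
      then have "sqrt (enn2real (H2_norm_sq (\<lambda>z. f z + g z))) \<le> ?a + ?b"
        using pos by (intro real_le_lsqrt) auto
      then show "sqrt (enn2real (H2_norm_sq (\<lambda>z. f z + g z)))
        \<le> sqrt (enn2real (H2_norm_sq f)) + sqrt (enn2real (H2_norm_sq g)) + e"
        by simp
    qed
  qed
  show "norm (a *\<^sub>R f) = \<bar>a\<bar> * norm f"
    by transfer (auto simp: H2_set_def H2_norm_sq_cmult enn2real_mult real_sqrt_mult)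
qed

end

section \<open>Operators\<close>

definition bounded_operator :: "(H2 \<Rightarrow> H2) \<Rightarrow> bool" where
  "bounded_operator T \<longleftrightarrow> bounded_linear T \<and> (\<forall>c f. T (scaleC_H2 c f) = scaleC_H2 c (T f))"

definition compact_operator :: "(H2 \<Rightarrow> H2) \<Rightarrow> bool" where
  "compact_operator K \<longleftrightarrow> bounded_operator K \<and> compact (closure (K ` cball 0 1))"

definition essential_norm :: "(H2 \<Rightarrow> H2) \<Rightarrow> real" where
  "essential_norm T = (INF K\<in>{K. compact_operator K}. onorm (\<lambda>f. T f - K f))"

definition compose_H2 :: "(complex \<Rightarrow> complex) \<Rightarrow> (complex \<Rightarrow> complex) \<Rightarrow> complex \<Rightarrow> complex" where
  "compose_H2 \<phi> f = (\<lambda>z. if z \<in> half_plane then f (\<phi> z) else 0)"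

text \<open>Meaningful only when composition with \<open>\<phi>\<close> maps the Hardy space into itself.\<close>

definition composition_operator :: "(complex \<Rightarrow> complex) \<Rightarrow> H2 \<Rightarrow> H2" where
  "composition_operator \<phi> f = Abs_H2 (compose_H2 \<phi> (Rep_H2 f))"

definition bounded_composition :: "(complex \<Rightarrow> complex) \<Rightarrow> bool" where
  "bounded_composition \<phi> \<longleftrightarrow>
     compose_H2 \<phi> ` H2_set \<subseteq> H2_set \<and> bounded_operator (composition_operator \<phi>)"

end

theory Submission
  imports Defs
begin

text \<open>
  Let \<open>c\<close> be the infimum of \<open>Re (\<phi> z) / Re z\<close>. Testing the composition operator \<open>T\<close> on reproducing
  kernels shows that \<open>c > 0\<close> when \<open>T\<close> is bounded. Both norms are equal to \<open>sqrt (1 / c)\<close>.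

  Upper bound: \<open>|f|\<^sup>2\<close> lies below the Poisson integral of its values on a vertical line, so by
  Fubini it suffices to integrate the positive harmonic functions \<open>Re (1 / (\<phi> z - p))\<close> along a
  vertical line; their integral is read off from the decay \<open>1 / (c s)\<close> at infinity.

  Lower bound: by the Schwarz--Pick inequality \<open>\<phi> x / x\<close> tends to \<open>c\<close> along the real axis.
  Hence \<open>norm (T u)\<close> is asymptotically at least \<open>sqrt (1 / c)\<close> for the normalised kernels \<open>u\<close> at
  \<open>4 ^ n\<close>, while a compact operator maps a subsequence of these nearly orthonormal kernels to a
  null sequence.
\<close>

section \<open>Slices of Hardy functions\<close>

text \<open>The classical lower bound uses that the adjoint of \<open>T\<close> maps the kernel at
  \<open>w\<close> to the kernel at \<open>\<phi> w\<close>, and that normalised kernels tend weakly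
  to zero. Here \<open>H2\<close> carries a norm only, so both facts become norm estimates:
  \<open>T\<close> applied to a kernel is evaluated at one point and compared with the sharp bound
  \<open>H2_pointwise\<close>, and weak convergence is replaced by the slow growth of the norms of
  long sums of kernels. The kernel at \<open>4 ^ n\<close> is tested at the point
  \<open>4 ^ n / c\<close>: since \<open>\<phi> x\<close> is close to \<open>c * x\<close>, this
  point is carried close to \<open>4 ^ n\<close>, where evaluation of that kernel is nearly
  extremal. Boundary values are avoided as well: all integrals run over lines inside the half-plane.
  The price is that the Poisson formula needs a bounded function to the right of the line, so the
  crude bound \<open>H2_bounded\<close> has to come before the sharp one.\<close>

lemma has_bochner_integral_cauchy_kernel:
  fixes a b :: real
  assumes "a > 0"
  shows "has_bochner_integral lborel (\<lambda>y. 1 / (a\<^sup>2 + (y - b)\<^sup>2)) (pi / a)"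
proof -
  let ?f = "\<lambda>y. 1 / (a\<^sup>2 + (y - b)\<^sup>2)" and ?F = "\<lambda>y. arctan ((y - b) / a) / a"
  have nz: "a\<^sup>2 + (y - b)\<^sup>2 \<noteq> 0" for y
    using assms by (simp add: add_pos_nonneg less_imp_neq[symmetric])
  have deriv: "DERIV ?F y :> ?f y" for y
  proof -
    have "a\<^sup>2 * (1 + ((y - b) / a)\<^sup>2) = a\<^sup>2 + (y - b)\<^sup>2"
      using assms by (simp add: power_divide distrib_left)
    moreover have "inverse (1 + u\<^sup>2) * ((1 - 0) / a) / a = 1 / (a\<^sup>2 * (1 + u\<^sup>2))" for u
      by (simp add: divide_inverse power2_eq_square ac_simps)
    ultimately have eq: "?f y = inverse (1 + ((y - b) / a)\<^sup>2) * ((1 - 0) / a) / a"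
      by simp
    show ?thesis
      unfolding eq by (intro DERIV_cdivide DERIV_chain2[OF DERIV_arctan] DERIV_diff DERIV_ident DERIV_const)
  qed
  have top: "(?F \<longlongrightarrow> (pi / 2) / a) at_top"
    using assms
    by (intro tendsto_divide filterlim_compose[OF tendsto_arctan_at_top] tendsto_const) (real_asymp, simp)
  have bot: "(?F \<longlongrightarrow> (- pi / 2) / a) at_bot"
    using assms
    by (intro tendsto_divide filterlim_compose[OF tendsto_arctan_at_bot] tendsto_const) (real_asymp, simp)
  have "set_integrable lborel (einterval (-\<infinity>) \<infinity>) ?f"
    "(LBINT y=-\<infinity>..\<infinity>. ?f y) = (pi / 2) / a - (- pi / 2) / a"
    using nz bot top
    by (intro interval_integral_FTC_nonneg[of _ _ ?F]; force intro!: deriv continuous_intros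
          simp: ereal_tendsto_simps)+
  then show ?thesis
    unfolding has_bochner_integral_iff
    by (simp add: set_integrable_def interval_lebesgue_integral_def set_lebesgue_integral_def
        field_simps)
qed

lemma nn_integral_cauchy_kernel:
  fixes a b :: real
  assumes "a > 0"
  shows "(\<integral>\<^sup>+ y. ennreal (1 / (a\<^sup>2 + (y - b)\<^sup>2)) \<partial>lborel) = ennreal (pi / a)"
  using has_bochner_integral_cauchy_kernel[OF assms, of b]
  by (subst nn_integral_eq_integral) (auto simp: has_bochner_integral_iff)

lemma has_integral_vertical_segment:
  assumes "a \<le> b"
    and "\<And>y. y \<in> {a..b} \<Longrightarrow> (G has_field_derivative g (Complex x y)) (at (Complex x y))"
  shows "((\<lambda>y. \<i> * g (Complex x y)) has_integral (G (Complex x b) - G (Complex x a))) {a..b}"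
proof (rule fundamental_theorem_of_calculus[OF assms(1)])
  fix y assume y: "y \<in> {a..b}"
  have "((\<lambda>y. Complex x y) has_vector_derivative \<i>) (at y within {a..b})"
    unfolding Complex_eq has_vector_derivative_def
    by (auto intro!: derivative_eq_intros simp: scaleR_conv_of_real)
  then show "((\<lambda>y. G (Complex x y)) has_vector_derivative (\<i> * g (Complex x y))) (at y within {a..b})"
    using field_vector_diff_chain_within[of "Complex x" \<i> y "{a..b}" G "g (Complex x y)"]
      assms(2)[OF y] by (auto simp: o_def has_field_derivative_at_within)
qed

lemma slice_norm_sq_le:
  assumes "x > 0"
  shows "(\<integral>\<^sup>+ y. ennreal ((cmod (Rep_H2 f (Complex x y)))\<^sup>2) \<partial>lborel) \<le> ennreal (2 * pi * (norm f)\<^sup>2)"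
proof -
  let ?I = "\<integral>\<^sup>+ y. ennreal ((cmod (Rep_H2 f (Complex x y)))\<^sup>2) \<partial>lborel"
  have "H2_norm_sq (Rep_H2 f) < \<infinity>" using Rep_H2[of f] by (simp add: H2_set_def)
  then have eq: "H2_norm_sq (Rep_H2 f) = ennreal ((norm f)\<^sup>2)" by (simp add: norm_H2.rep_eq)
  have "ennreal (1 / (2 * pi)) * ?I \<le> ennreal ((norm f)\<^sup>2)"
    unfolding eq[symmetric] H2_norm_sq_def using assms by (intro SUP_upper) auto
  then have "ennreal (2 * pi) * (ennreal (1 / (2 * pi)) * ?I) \<le> ennreal (2 * pi) * ennreal ((norm f)\<^sup>2)"
    by (rule mult_left_mono) simp
  then show ?thesis
    by (simp add: mult.assoc[symmetric] ennreal_mult[symmetric])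
qed

lemma H2_norm_sq_le_slices:
  assumes "\<And>x. x > 0 \<Longrightarrow>
      (\<integral>\<^sup>+ y. ennreal ((cmod (f (Complex x y)))\<^sup>2) \<partial>lborel) \<le> ennreal (2 * pi * C)"
    and "C \<ge> 0"
  shows "H2_norm_sq f \<le> ennreal C"
  unfolding H2_norm_sq_def
proof (rule SUP_least)
  fix x :: real assume "x \<in> {0<..}"
  then have "ennreal (1 / (2 * pi)) * (\<integral>\<^sup>+ y. ennreal ((cmod (f (Complex x y)))\<^sup>2) \<partial>lborel)
     \<le> ennreal (1 / (2 * pi)) * ennreal (2 * pi * C)"
    by (intro mult_left_mono assms) auto
  also have "\<dots> = ennreal C"
    using assms(2) by (simp add: ennreal_mult[symmetric])
  finally show "ennreal (1 / (2 * pi)) * (\<integral>\<^sup>+ y. ennreal ((cmod (f (Complex x y)))\<^sup>2) \<partial>lborel)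
     \<le> ennreal C" .
qed

lemma norm_H2_le:
  assumes "H2_norm_sq (Rep_H2 f) \<le> ennreal (C\<^sup>2)" "C \<ge> 0"
  shows "norm f \<le> C"
proof -
  have "enn2real (H2_norm_sq (Rep_H2 f)) \<le> C\<^sup>2"
    using assms by (intro enn2real_leI) auto
  then show ?thesis
    unfolding norm_H2.rep_eq using assms(2) by (simp add: real_le_lsqrt)
qed

lemma Rep_H2_holomorphic: "Rep_H2 f holomorphic_on half_plane"
  using Rep_H2[of f] by (simp add: H2_set_def)

lemma open_half_plane: "open half_plane"
  unfolding half_plane_def by (rule open_halfspace_Re_gt)

lemma convex_half_plane: "convex half_plane"
  unfolding half_plane_def by (rule convex_halfspace_Re_gt)

text \<open>For a primitive \<open>G\<close> of \<open>f\<^sup>2\<close>, the function \<open>G (z + i h) - G z\<close> is bounded by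
  the norm of \<open>f\<close>, uniformly in \<open>h\<close>; Cauchy's estimate then bounds
  \<open>(f (z + i h))\<^sup>2 - (f z)\<^sup>2\<close>, and \<open>f\<close> is square integrable on vertical lines.\<close>

lemma H2_bounded:
  assumes r: "r > 0" and z: "Re z > r"
  shows "(cmod (Rep_H2 f z))\<^sup>2 \<le> 2 * pi * (norm f)\<^sup>2 / r"
proof (rule ccontr)
  define M where "M = 2 * pi * (norm f)\<^sup>2"
  define g where "g = (\<lambda>z. (Rep_H2 f z)\<^sup>2)"
  have g: "g holomorphic_on half_plane"
    unfolding g_def by (intro holomorphic_intros Rep_H2_holomorphic)
  obtain G where "\<And>z. z \<in> half_plane \<Longrightarrow> (G has_field_derivative g z) (at z within half_plane)"
    using holomorphic_convex_primitive'[OF convex_half_plane open_half_plane g] by blast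
  then have G: "(G has_field_derivative g z) (at z)" if "z \<in> half_plane" for z
    using that by (simp add: at_within_open[OF _ open_half_plane])
  \<comment> \<open>The increment is the integral of \<open>\<i> * g\<close> over the segment, and
    \<open>cmod g\<close> is the square modulus of \<open>f\<close>, so the slice integral bounds it
    whatever the length of the segment.\<close>
  have incr: "cmod (G (Complex x b) - G (Complex x a)) \<le> M" if x: "x > 0" and "a \<le> b" for x a b
  proof -
    have c: "continuous_on S (\<lambda>y. g (Complex x y))" for S
      using slice_measurable(1)[OF g x] continuous_on_subset by blast
    have hi: "((\<lambda>y. \<i> * g (Complex x y)) has_integral (G (Complex x b) - G (Complex x a))) {a..b}"
      using x that(2) by (intro has_integral_vertical_segment G) (auto simp: half_plane_def)
    have int: "set_integrable lborel {a..b} (\<lambda>y. \<i> * g (Complex x y))"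
      by (intro borel_integrable_atLeastAtMost' continuous_intros c)
    from int have "integral {a..b} (\<lambda>y. \<i> * g (Complex x y)) = (LBINT y:{a..b}. \<i> * g (Complex x y))"
      by (rule set_borel_integral_eq_integral(2)[symmetric])
    with hi have "G (Complex x b) - G (Complex x a) = (LBINT y:{a..b}. \<i> * g (Complex x y))"
      by (metis integral_unique)
    then have "ennreal (cmod (G (Complex x b) - G (Complex x a)))
       \<le> (\<integral>\<^sup>+ y. ennreal (norm (indicator {a..b} y *\<^sub>R (\<i> * g (Complex x y)))) \<partial>lborel)"
      unfolding set_lebesgue_integral_def
      by (simp only: integral_norm_bound_ennreal[OF int[unfolded set_integrable_def]])
    also have "\<dots> \<le> (\<integral>\<^sup>+ y. ennreal ((cmod (Rep_H2 f (Complex x y)))\<^sup>2) \<partial>lborel)"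
      by (intro nn_integral_mono) (auto simp: indicator_def g_def norm_mult norm_power)
    also have "\<dots> \<le> ennreal M" unfolding M_def by (rule slice_norm_sq_le[OF x])
    finally show ?thesis by (subst (asm) ennreal_le_iff) (auto simp: M_def)
  qed
  have dist: "cmod (g (z + \<i> * of_real h) - g z) \<le> M / r" for h
  proof -
    let ?A = "\<lambda>z. G (z + \<i> * of_real h) - G z"
    have dA: "(?A has_field_derivative (g (w + \<i> * of_real h) - g w)) (at w)" if "w \<in> half_plane" for w
    proof -
      have "(G has_field_derivative g (w + \<i> * of_real h)) (at (w + \<i> * of_real h))"
        using that by (intro G) (simp add: half_plane_def)
      then have "((\<lambda>z. G (z + \<i> * of_real h)) has_field_derivative g (w + \<i> * of_real h)) (at w)"
        by (simp add: DERIV_shift)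
      then show ?thesis using G[OF that] by (rule DERIV_diff)
    qed
    have sub: "cball z r \<subseteq> half_plane"
    proof
      fix w assume "w \<in> cball z r"
      then have "\<bar>Re (z - w)\<bar> \<le> r"
        using abs_Re_le_cmod[of "z - w"] by (simp add: dist_norm)
      then show "w \<in> half_plane" using z by (simp add: half_plane_def)
    qed
    have hol: "?A holomorphic_on half_plane"
      using dA by (intro holomorphic_onI) (auto simp: field_differentiable_def intro: has_field_derivative_at_within)
    have "cmod ((deriv ^^ 1) ?A z) \<le> fact 1 * M / r ^ 1"
    proof (rule Cauchy_inequality)
      show "?A holomorphic_on ball z r"
        using hol sub ball_subset_cball holomorphic_on_subset by blast
      show "continuous_on (cball z r) ?A"
        using hol sub holomorphic_on_imp_continuous_on holomorphic_on_subset by blast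
      fix w assume "cmod (z - w) = r"
      then have "w \<in> half_plane" using sub by (auto simp: dist_norm)
      then have w: "Re w > 0" by (simp add: half_plane_def)
      have eq: "w + \<i> * of_real h = Complex (Re w) (Im w + h)" "w = Complex (Re w) (Im w)"
        by (auto simp: complex_eq_iff)
      show "cmod (?A w) \<le> M"
      proof (cases "h \<ge> 0")
        case True then show ?thesis using incr[OF w, of "Im w" "Im w + h"] eq by simp
      next
        case False then show ?thesis using incr[OF w, of "Im w + h" "Im w"] eq
          by (metis add_le_same_cancel1 linear norm_minus_commute)
      qed
    qed (use r in auto)
    moreover have "deriv ?A z = g (z + \<i> * of_real h) - g z"
      using z r by (intro DERIV_imp_deriv dA) (simp add: half_plane_def)
    ultimately show ?thesis by simp
  qed
  assume "\<not> ?thesis"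
  then have gt: "cmod (g z) > M / r" by (simp add: g_def norm_power M_def)
  \<comment> \<open>By \<open>dist\<close>, \<open>g\<close> deviates from \<open>g z\<close> by at
    most \<open>M / r\<close> on the vertical line through \<open>z\<close>. A gap
    \<open>d > 0\<close> would therefore bound the square modulus of \<open>f\<close> from below on
    a line of infinite length, against the finite slice integral.\<close>
  define d where "d = cmod (g z) - M / r"
  have d: "d > 0" using gt by (simp add: d_def)
  have lower: "d \<le> (cmod (Rep_H2 f (Complex (Re z) y)))\<^sup>2" for y
  proof -
    have "z + \<i> * of_real (y - Im z) = Complex (Re z) y" by (simp add: complex_eq_iff)
    then have "cmod (g (Complex (Re z) y) - g z) \<le> M / r" using dist[of "y - Im z"] by simp
    then have "d \<le> cmod (g (Complex (Re z) y))"
      unfolding d_def using norm_triangle_ineq2[of "g z" "g (Complex (Re z) y)"]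
      by (simp add: norm_minus_commute)
    then show ?thesis by (simp add: g_def norm_power)
  qed
  have "(\<integral>\<^sup>+ y. ennreal d \<partial>(lborel :: real measure)) \<le> (\<integral>\<^sup>+ y. ennreal ((cmod (Rep_H2 f (Complex (Re z) y)))\<^sup>2) \<partial>lborel)"
    by (intro nn_integral_mono ennreal_leI lower)
  also have "\<dots> \<le> ennreal M" unfolding M_def using z r by (intro slice_norm_sq_le) auto
  finally show False using d by (simp add: ennreal_mult_top top_unique)
qed

section \<open>The Poisson formula on a half-plane\<close>

lemma continuous_on_vertical_line:
  assumes "continuous_on A f" "\<And>y. Complex x y \<in> A"
  shows "continuous_on S (\<lambda>y. f (Complex x y))"
proof (rule continuous_on_compose2[OF assms(1)])
  show "continuous_on S (Complex x)"
    unfolding Complex_eq by (intro continuous_intros)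
qed (use assms(2) in auto)

text \<open>Up to sign, the integrand is \<open>Q z = (F z - F w) / ((z - w) * (z - v))\<close> on the line
  \<open>Re z = x\<close>, where \<open>v\<close> is the reflection of \<open>w\<close> in that line. A primitive of \<open>Q\<close> varies by
  \<open>O(1 / M)\<close> along the other three sides of a rectangle of size \<open>M\<close>.\<close>

lemma poisson_integral_truncated:
  fixes F :: "complex \<Rightarrow> complex"
  assumes F: "F holomorphic_on {z. Re z > x0}" and x: "x0 < x" and s: "s > 0"
    and bdd: "\<And>z. Re z \<ge> x \<Longrightarrow> cmod (F z) \<le> B"
  shows "((\<lambda>M. LBINT y:{-M..M}. (F (Complex x y) - F (Complex (x + s) t)) / of_real (s\<^sup>2 + (y - t)\<^sup>2))
           \<longlongrightarrow> 0) at_top"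
proof -
  define w v where "w = Complex (x + s) t" and "v = Complex (x - s) t"
  \<comment> \<open>A convex open set that contains the closed half-plane right of the line but
    omits \<open>v\<close>, so the only singularity left for \<open>Q\<close> is the removable one
    at \<open>w\<close>, which \<open>q\<close> fills in.\<close>
  define S where "S = {z. Re z > max x0 (x - s)}"
  define q where "q = (\<lambda>z. if z = w then deriv F w else (F z - F w) / (z - w))"
  define Q where "Q = (\<lambda>z. q z / (z - v))"
  have S: "open S" "convex S"
    unfolding S_def by (rule open_halfspace_Re_gt convex_halfspace_Re_gt)+
  have "w \<in> {z. Re z > x0}" using x s by (simp add: w_def)
  then have "q holomorphic_on {z. Re z > x0}"
    unfolding q_def by (intro pole_lemma F) (simp add: interior_open open_halfspace_Re_gt)
  then have "q holomorphic_on S"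
    by (rule holomorphic_on_subset) (auto simp: S_def)
  then have Q: "Q holomorphic_on S"
    unfolding Q_def by (intro holomorphic_intros) (auto simp: S_def v_def)
  obtain P where "\<And>z. z \<in> S \<Longrightarrow> (P has_field_derivative Q z) (at z within S)"
    using holomorphic_convex_primitive'[OF S(2,1) Q] by blast
  then have P: "(P has_field_derivative Q z) (at z)" if "z \<in> S" for z
    using that by (simp add: at_within_open[OF _ S(1)])
  have inS: "z \<in> S" if "Re z \<ge> x" for z
    using that x s by (simp add: S_def)
  have Q_line: "Q (Complex x y) = - ((F (Complex x y) - F w) / of_real (s\<^sup>2 + (y - t)\<^sup>2))" for y
  proof -
    have "Complex x y \<noteq> w" using s by (auto simp: w_def)
    moreover have "(Complex x y - w) * (Complex x y - v) = - of_real (s\<^sup>2 + (y - t)\<^sup>2)"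
      by (simp add: w_def v_def complex_eq_iff power2_eq_square algebra_simps)
    ultimately show ?thesis
      by (simp add: Q_def q_def del: of_real_add of_real_power)
  qed
  have "B \<ge> 0" using bdd[of w] s by (auto simp: w_def intro: order_trans[OF norm_ge_zero])
  \<comment> \<open>\<open>w\<close> and \<open>v\<close> are equally far from
    \<open>of_real x\<close>, at most \<open>M / 2\<close>. Points at distance at least
    \<open>M\<close> thus keep \<open>M / 2\<close> away from both, and
    \<open>2 * B / (M / 2)^2\<close> is the constant.\<close>
  have segment: "cmod (P b - P a) \<le> 8 * B / M\<^sup>2 * cmod (b - a)"
    if sub: "\<And>z. z \<in> closed_segment a b \<Longrightarrow> Re z \<ge> x \<and> cmod (z - of_real x) \<ge> M"
      and M: "M \<ge> 2 * (cmod (w - of_real x))" "M > 0" for a b M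
  proof (rule field_differentiable_bound[of "closed_segment a b" P Q])
    fix z assume z: "z \<in> closed_segment a b"
    from sub[OF z] have zr: "Re z \<ge> x" and zM: "cmod (z - of_real x) \<ge> M" by auto
    show "(P has_field_derivative Q z) (at z within closed_segment a b)"
      using P[OF inS[OF zr]] by (rule has_field_derivative_at_within)
    have "cmod (z - w) \<ge> M / 2"
      using norm_triangle_ineq2[of "z - of_real x" "w - of_real x"] zM M by simp
    moreover have "cmod (v - of_real x) = cmod (w - of_real x)"
      by (simp add: v_def w_def cmod_def)
    then have "cmod (z - v) \<ge> M / 2"
      using norm_triangle_ineq2[of "z - of_real x" "v - of_real x"] zM M by simp
    moreover have "cmod (F z - F w) \<le> 2 * B"
      using norm_triangle_ineq4[of "F z" "F w"] bdd[OF zr] bdd[of w] s by (simp add: w_def)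
    moreover have "Q z = (F z - F w) / ((z - w) * (z - v))"
      using calculation(1) M by (auto simp: Q_def q_def)
    ultimately have "cmod (Q z) \<le> 2 * B / (M / 2 * (M / 2))"
      using M \<open>B \<ge> 0\<close> by (simp only: norm_divide norm_mult) (intro frac_le mult_mono, auto)
    then show "cmod (Q z) \<le> 8 * B / M\<^sup>2"
      by (simp add: power2_eq_square)
  qed auto
  \<comment> \<open>The three remaining sides have lengths \<open>M\<close>, \<open>2 * M\<close>
    and \<open>M\<close>, hence \<open>8 * 4 = 32\<close>.\<close>
  have bound: "cmod (LBINT y:{-M..M}. (F (Complex x y) - F w) / of_real (s\<^sup>2 + (y - t)\<^sup>2)) \<le> 32 * B / M"
    if M: "M \<ge> 2 * (cmod (w - of_real x))" "M > 0" for M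
  proof -
    let ?a = "Complex x (-M)" and ?b = "Complex (x + M) (-M)" and ?c = "Complex (x + M) M" and ?d = "Complex x M"
    have ge: "cmod (z - of_real x) \<ge> M" if "\<bar>Re z - x\<bar> \<ge> M \<or> \<bar>Im z\<bar> \<ge> M" for z
      using that abs_Re_le_cmod[of "z - of_real x"] abs_Im_le_cmod[of "z - of_real x"] by auto
    have low: "Re z \<ge> x \<and> Im z \<le> - M" if "z \<in> closed_segment ?a ?b" for z
      using closed_segment_subset[of ?a "{z. Re z \<ge> x} \<inter> {z. Im z \<le> - M}" ?b] that M
      by (auto simp: convex_Int convex_halfspace_Re_ge convex_halfspace_Im_le)
    have right: "Re z \<ge> x + M" if "z \<in> closed_segment ?b ?c" for z
      using closed_segment_subset[of ?b "{z. Re z \<ge> x + M}" ?c] that M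
      by (auto simp: convex_halfspace_Re_ge)
    have up: "Re z \<ge> x \<and> Im z \<ge> M" if "z \<in> closed_segment ?c ?d" for z
      using closed_segment_subset[of ?c "{z. Re z \<ge> x} \<inter> {z. Im z \<ge> M}" ?d] that M
      by (auto simp: convex_Int convex_halfspace_Re_ge convex_halfspace_Im_ge)
    have 1: "cmod (P ?b - P ?a) \<le> 8 * B / M\<^sup>2 * cmod (?b - ?a)"
      using M by (intro segment ge conjI) (force dest: low)+
    have 2: "cmod (P ?c - P ?b) \<le> 8 * B / M\<^sup>2 * cmod (?c - ?b)"
      using M by (intro segment ge conjI) (force dest: right)+
    have 3: "cmod (P ?d - P ?c) \<le> 8 * B / M\<^sup>2 * cmod (?d - ?c)"
      using M by (intro segment ge conjI) (force dest: up)+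
    have diff: "?b - ?a = of_real M" "?c - ?b = \<i> * of_real (2 * M)" "?d - ?c = - of_real M"
      by (simp_all add: complex_eq_iff)
    have len: "cmod (?b - ?a) = M" "cmod (?c - ?b) = 2 * M" "cmod (?d - ?c) = M"
      unfolding diff using M by (simp_all add: norm_mult)
    have sum: "P ?d - P ?a = (P ?b - P ?a) + (P ?c - P ?b) + (P ?d - P ?c)" by simp
    have "cmod (P ?d - P ?a) \<le> cmod (P ?b - P ?a) + cmod (P ?c - P ?b) + cmod (P ?d - P ?c)"
      unfolding sum
      using norm_triangle_ineq[of "(P ?b - P ?a) + (P ?c - P ?b)" "P ?d - P ?c"]
        norm_triangle_ineq[of "P ?b - P ?a" "P ?c - P ?b"]
      by linarith
    also have "\<dots> \<le> 8 * B / M\<^sup>2 * (4 * M)"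
      using 1 2 3 unfolding len by simp
    also have "\<dots> = 32 * B / M" using M by (simp add: power2_eq_square)
    finally have le: "cmod (P ?d - P ?a) \<le> 32 * B / M" .
    have hi: "((\<lambda>y. \<i> * Q (Complex x y)) has_integral (P ?d - P ?a)) {-M..M}"
      using M by (intro has_integral_vertical_segment P inS) auto
    have c: "continuous_on {-M..M} (\<lambda>y. Q (Complex x y))"
      by (rule continuous_on_vertical_line[OF holomorphic_on_imp_continuous_on[OF Q]]) (simp add: inS)
    have "integral {-M..M} (\<lambda>y. \<i> * Q (Complex x y)) = (LBINT y:{-M..M}. \<i> * Q (Complex x y))"
      by (intro set_borel_integral_eq_integral(2)[symmetric] borel_integrable_atLeastAtMost' continuous_intros c)
    also have "\<dots> = - \<i> * (LBINT y:{-M..M}. (F (Complex x y) - F w) / of_real (s\<^sup>2 + (y - t)\<^sup>2))"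
      unfolding Q_line by (subst set_integral_mult_right) (simp add: set_lebesgue_integral_def)
    finally have "P ?d - P ?a = - \<i> * (LBINT y:{-M..M}. (F (Complex x y) - F w) / of_real (s\<^sup>2 + (y - t)\<^sup>2))"
      using hi by (metis integral_unique)
    with le show ?thesis by (simp add: norm_mult)
  qed
  show ?thesis
    unfolding w_def[symmetric]
  proof (rule Lim_null_comparison)
    show "\<forall>\<^sub>F M in at_top. cmod (LBINT y:{-M..M}. (F (Complex x y) - F w) / of_real (s\<^sup>2 + (y - t)\<^sup>2)) \<le> 32 * B / M"
      using eventually_ge_at_top[of "2 * (cmod (w - of_real x))"] eventually_gt_at_top[of 0]
      by eventually_elim (rule bound)
    show "((\<lambda>M. 32 * B / M) \<longlongrightarrow> 0) at_top" by real_asymp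
  qed
qed

text \<open>Boundedness of \<open>F\<close> makes the integrand absolutely integrable, so by
  dominated convergence the vanishing truncated integrals give a full integral of zero for
  \<open>F - F w\<close>. The constant \<open>F w\<close> contributes the total mass
  \<open>pi / s\<close> of the kernel.\<close>

lemma poisson_formula:
  fixes F :: "complex \<Rightarrow> complex"
  assumes F: "F holomorphic_on {z. Re z > x0}" and x: "x0 < x" and s: "s > 0"
    and bdd: "\<And>z. Re z \<ge> x \<Longrightarrow> cmod (F z) \<le> B"
  shows "has_bochner_integral lborel (\<lambda>y. F (Complex x y) / of_real (s\<^sup>2 + (y - t)\<^sup>2))
           (of_real (pi / s) * F (Complex (x + s) t))"
proof -
  define w where "w = Complex (x + s) t"
  let ?k = "\<lambda>y. 1 / (s\<^sup>2 + (y - t)\<^sup>2)"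
  have k: "has_bochner_integral lborel ?k (pi / s)"
    by (rule has_bochner_integral_cauchy_kernel[OF s])
  have "continuous_on UNIV (\<lambda>y. F (Complex x y))"
    using x by (intro continuous_on_vertical_line[OF holomorphic_on_imp_continuous_on[OF F]]) simp
  then have [measurable]: "(\<lambda>y. F (Complex x y)) \<in> borel_measurable lborel"
    using borel_measurable_continuous_onI by simp
  have int: "integrable lborel (\<lambda>y. F (Complex x y) / of_real (s\<^sup>2 + (y - t)\<^sup>2))"
  proof (rule Bochner_Integration.integrable_bound)
    show "integrable lborel (\<lambda>y. B * ?k y)"
      using k by (intro integrable_mult_right) (simp add: has_bochner_integral_iff)
    have "cmod (F (Complex x y) / of_real (s\<^sup>2 + (y - t)\<^sup>2)) \<le> norm (B * ?k y)" for y
      using bdd[of "Complex x y"] by (simp add: norm_divide divide_right_mono del: of_real_add of_real_power)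
    then show "AE y in lborel. cmod (F (Complex x y) / of_real (s\<^sup>2 + (y - t)\<^sup>2)) \<le> norm (B * ?k y)"
      by simp
  qed measurable
  have kc: "has_bochner_integral lborel (\<lambda>y. F w * of_real (?k y)) (F w * of_real (pi / s))"
    using k by (intro has_bochner_integral_mult_right has_bochner_integral_of_real)
  let ?d = "\<lambda>y. (F (Complex x y) - F w) / of_real (s\<^sup>2 + (y - t)\<^sup>2)"
  have d_eq: "?d = (\<lambda>y. F (Complex x y) / of_real (s\<^sup>2 + (y - t)\<^sup>2) - F w * of_real (?k y))"
    by (simp add: fun_eq_iff diff_divide_distrib)
  have intd: "integrable lborel ?d"
    unfolding d_eq using int kc by (intro Bochner_Integration.integrable_diff) (auto simp: has_bochner_integral_iff)
  have "((\<lambda>M. LBINT y:{-M..M}. ?d y) \<longlongrightarrow> (LINT y|lborel. ?d y)) at_top"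
    unfolding set_lebesgue_integral_def
  proof (rule integral_dominated_convergence_at_top[where w = "\<lambda>y. cmod (?d y)"])
    show "integrable lborel (\<lambda>y. cmod (?d y))" using intd by (rule integrable_norm)
    show "AE y in lborel. ((\<lambda>M. indicator {-M..M} y *\<^sub>R ?d y) \<longlongrightarrow> ?d y) at_top"
    proof (rule AE_I2)
      fix y :: real
      show "((\<lambda>M. indicator {-M..M} y *\<^sub>R ?d y) \<longlongrightarrow> ?d y) at_top"
        by (intro tendsto_eventually eventually_mono[OF eventually_ge_at_top[of "\<bar>y\<bar>"]])
          (auto simp: indicator_def)
    qed
    show "\<forall>\<^sub>F M in at_top. AE y in lborel. norm (indicator {-M..M} y *\<^sub>R ?d y) \<le> cmod (?d y)"
      by (intro always_eventually allI AE_I2) (auto simp: indicator_def)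
  qed measurable
  moreover have "((\<lambda>M. LBINT y:{-M..M}. ?d y) \<longlongrightarrow> 0) at_top"
    unfolding w_def using assms by (rule poisson_integral_truncated)
  ultimately have "(LINT y|lborel. ?d y) = 0"
    using tendsto_unique trivial_limit_at_top_linorder by blast
  then show ?thesis
    using int kc unfolding d_eq has_bochner_integral_iff w_def[symmetric]
    by (subst (asm) Bochner_Integration.integral_diff) (auto simp: mult.commute)
qed

lemma poisson_norm_le:
  fixes F :: "complex \<Rightarrow> complex"
  assumes "F holomorphic_on {z. Re z > x0}" "x0 < x" and s: "s > 0"
    and "\<And>z. Re z \<ge> x \<Longrightarrow> cmod (F z) \<le> B"
  shows "ennreal (pi / s * cmod (F (Complex (x + s) t)))
     \<le> (\<integral>\<^sup>+ y. ennreal (cmod (F (Complex x y)) / (s\<^sup>2 + (y - t)\<^sup>2)) \<partial>lborel)"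
proof -
  note P = poisson_formula[OF assms, of t]
  have "pi / s * cmod (F (Complex (x + s) t)) = cmod (of_real (pi / s) * F (Complex (x + s) t))"
    using s by (simp add: norm_mult norm_divide)
  also have "ennreal \<dots> \<le> (\<integral>\<^sup>+ y. ennreal (cmod (F (Complex x y) / of_real (s\<^sup>2 + (y - t)\<^sup>2))) \<partial>lborel)"
    using P integral_norm_bound_ennreal[of lborel "\<lambda>y. F (Complex x y) / of_real (s\<^sup>2 + (y - t)\<^sup>2)"]
    unfolding has_bochner_integral_iff by simp
  finally show ?thesis
    by (simp add: norm_divide del: of_real_add of_real_power)
qed

lemma poisson_Re_eq:
  fixes F :: "complex \<Rightarrow> complex"
  assumes "F holomorphic_on {z. Re z > x0}" "x0 < x" and s: "s > 0"
    and "\<And>z. Re z \<ge> x \<Longrightarrow> cmod (F z) \<le> B"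
    and nonneg: "\<And>y. Re (F (Complex x y)) \<ge> 0"
  shows "(\<integral>\<^sup>+ y. ennreal (Re (F (Complex x y)) / (s\<^sup>2 + (y - t)\<^sup>2)) \<partial>lborel)
     = ennreal (pi / s * Re (F (Complex (x + s) t)))"
proof -
  note P = poisson_formula[OF assms(1-4), of t]
  have "has_bochner_integral lborel (\<lambda>y. Re (F (Complex x y) / of_real (s\<^sup>2 + (y - t)\<^sup>2)))
     (Re (of_real (pi / s) * F (Complex (x + s) t)))"
    by (rule has_bochner_integral_bounded_linear[OF bounded_linear_Re P])
  then have "has_bochner_integral lborel (\<lambda>y. Re (F (Complex x y)) / (s\<^sup>2 + (y - t)\<^sup>2))
     (pi / s * Re (F (Complex (x + s) t)))"
    by (simp add: Re_divide_of_real del: of_real_add of_real_power of_real_divide)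
  then show ?thesis
    using nonneg unfolding has_bochner_integral_iff by (subst nn_integral_eq_integral) auto
qed

text \<open>The square of \<open>f\<close> is holomorphic and its modulus is the quantity wanted, so
  \<open>poisson_norm_le\<close> applies. The kernel is written as a real part of a holomorphic
  function of \<open>w\<close>, so that it stays harmonic in \<open>z\<close> once
  \<open>\<phi> z\<close> is substituted for \<open>w\<close>.\<close>

lemma H2_subharmonic:
  assumes r: "0 < r" "r < Re w"
  shows "ennreal (pi * (cmod (Rep_H2 f w))\<^sup>2)
    \<le> (\<integral>\<^sup>+ y. ennreal ((cmod (Rep_H2 f (Complex r y)))\<^sup>2 * Re (1 / (w - Complex r y))) \<partial>lborel)"
proof -
  define s where "s = Re w - r"
  have s: "s > 0" using r by (simp add: s_def)
  note [measurable] = slice_measurable(2)[OF Rep_H2_holomorphic[of f] r(1)]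
  let ?F = "\<lambda>z. (Rep_H2 f z)\<^sup>2"
  have hol: "?F holomorphic_on {z. Re z > 0}"
    using Rep_H2_holomorphic[of f] unfolding half_plane_def by (intro holomorphic_intros)
  \<comment> \<open>\<open>H2_bounded\<close> needs a radius strictly below \<open>Re z\<close>;
    \<open>r / 2\<close> also covers the line \<open>Re z = r\<close> itself.\<close>
  have "cmod (?F z) \<le> 2 * pi * (norm f)\<^sup>2 / (r / 2)" if "Re z \<ge> r" for z
    unfolding norm_power using that r by (intro H2_bounded) auto
  from poisson_norm_le[OF hol r(1) s this, of "Im w"]
  have "ennreal (pi / s * (cmod (Rep_H2 f w))\<^sup>2)
    \<le> (\<integral>\<^sup>+ y. ennreal ((cmod (Rep_H2 f (Complex r y)))\<^sup>2 / (s\<^sup>2 + (y - Im w)\<^sup>2)) \<partial>lborel)"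
    by (simp add: s_def norm_power)
  then have "ennreal s * ennreal (pi / s * (cmod (Rep_H2 f w))\<^sup>2)
    \<le> ennreal s * (\<integral>\<^sup>+ y. ennreal ((cmod (Rep_H2 f (Complex r y)))\<^sup>2 / (s\<^sup>2 + (y - Im w)\<^sup>2)) \<partial>lborel)"
    by (rule mult_left_mono) simp
  also have "\<dots> = (\<integral>\<^sup>+ y. ennreal s * ennreal ((cmod (Rep_H2 f (Complex r y)))\<^sup>2 / (s\<^sup>2 + (y - Im w)\<^sup>2)) \<partial>lborel)"
    by (rule nn_integral_cmult[symmetric]) measurable
  also have "\<dots> = (\<integral>\<^sup>+ y. ennreal ((cmod (Rep_H2 f (Complex r y)))\<^sup>2 * Re (1 / (w - Complex r y))) \<partial>lborel)"
  proof (rule nn_integral_cong)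
    fix y
    have "Re (1 / (w - Complex r y)) = s / (s\<^sup>2 + (y - Im w)\<^sup>2)"
      by (simp add: Re_divide s_def power2_commute)
    then show "ennreal s * ennreal ((cmod (Rep_H2 f (Complex r y)))\<^sup>2 / (s\<^sup>2 + (y - Im w)\<^sup>2))
      = ennreal ((cmod (Rep_H2 f (Complex r y)))\<^sup>2 * Re (1 / (w - Complex r y)))"
      using s by (simp add: ennreal_mult'[symmetric] mult.commute)
  qed
  finally show ?thesis
    using s by (simp add: ennreal_mult'[symmetric])
qed

text \<open>The factor \<open>m\<close> turns the Poisson kernel into the reproducing kernel, whose square modulus
  on the boundary line is the Poisson kernel again; \<open>1 + e z\<close> keeps it bounded.\<close>

lemma H2_pointwise:
  assumes w: "Re w > 0"
  shows "(cmod (Rep_H2 f w))\<^sup>2 \<le> (norm f)\<^sup>2 / (2 * Re w)"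
proof -
  have approx: "(cmod (Rep_H2 f w))\<^sup>2 \<le> (cmod (1 + of_real r * w))\<^sup>2 * (norm f)\<^sup>2 / (2 * (Re w - r))"
    if r: "0 < r" "r < Re w" for r
  proof -
    define a where "a = Re w - r"
    define v where "v = Complex (r - a) (Im w)"
    \<comment> \<open>\<open>v\<close> is the reflection of \<open>w\<close> in the line
      \<open>Re z = r\<close>. So \<open>z - v\<close> equals \<open>2 * a\<close> at
      \<open>w\<close>, and its square modulus on the line cancels the denominator of the Poisson
      kernel. The same \<open>r\<close> is the abscissa of the line and the damping
      parameter.\<close>
    define m where "m = (\<lambda>z. (z - v) / (2 * of_real a * (1 + of_real r * z)))"
    have a: "a > 0" using r by (simp add: a_def)
    note [measurable] = slice_measurable(2)[OF Rep_H2_holomorphic[of f] r(1)]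
    have ge: "cmod (1 + of_real r * z) \<ge> 1" "cmod (1 + of_real r * z) \<ge> r * cmod z" if "Re z > 0" for z
    proof -
      have rz: "r * Re z > 0" using that r by simp
      have "1 + r * Re z \<le> cmod (1 + of_real r * z)"
        using complex_Re_le_cmod[of "1 + of_real r * z"] by simp
      then show "cmod (1 + of_real r * z) \<ge> 1" using rz by linarith
      have "(cmod (1 + of_real r * z))\<^sup>2 = (r * cmod z)\<^sup>2 + 2 * (r * Re z) + 1"
        unfolding power_mult_distrib cmod_power2 by (simp add: power2_eq_square algebra_simps)
      then have "(r * cmod z)\<^sup>2 \<le> (cmod (1 + of_real r * z))\<^sup>2"
        using rz by linarith
      then show "cmod (1 + of_real r * z) \<ge> r * cmod z"
        by (rule power2_le_imp_le) simp
    qed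
    have nz: "1 + of_real r * z \<noteq> 0" if "Re z > 0" for z
      using ge(1)[OF that] by auto
    let ?F = "\<lambda>z. (Rep_H2 f z * m z)\<^sup>2"
    have hol: "?F holomorphic_on {z. Re z > 0}"
      using Rep_H2_holomorphic[of f] a nz unfolding half_plane_def m_def
      by (intro holomorphic_intros) auto
    have "cmod (?F z) \<le> 2 * pi * (norm f)\<^sup>2 / (r / 2) * ((1 / r + cmod v) / (2 * a))\<^sup>2" if z: "Re z \<ge> r" for z
    proof -
      have z0: "Re z > 0" using z r by simp
      have "cmod (z - v) \<le> cmod z + cmod v" by (rule norm_triangle_ineq4)
      also have "\<dots> \<le> (1 / r) * cmod (1 + of_real r * z) + cmod v * cmod (1 + of_real r * z)"
        using ge[OF z0] r mult_left_mono[of 1 "cmod (1 + of_real r * z)" "cmod v"]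
        by (intro add_mono) (auto simp: field_simps)
      finally have "cmod (m z) \<le> (1 / r + cmod v) / (2 * a)"
        using a nz[OF z0] unfolding m_def norm_divide norm_mult
        by (simp add: field_simps)
      then show ?thesis
        unfolding norm_power norm_mult power_mult_distrib
        using r z by (intro mult_mono power_mono H2_bounded) auto
    qed
    from poisson_norm_le[OF hol r(1) a this, of "Im w"]
    have P: "ennreal (pi / a * cmod (?F w))
      \<le> (\<integral>\<^sup>+ y. ennreal (cmod (?F (Complex r y)) / (a\<^sup>2 + (y - Im w)\<^sup>2)) \<partial>lborel)"
      by (simp add: a_def)
    have "(\<integral>\<^sup>+ y. ennreal (cmod (?F (Complex r y)) / (a\<^sup>2 + (y - Im w)\<^sup>2)) \<partial>lborel)
      \<le> (\<integral>\<^sup>+ y. ennreal (1 / (4 * a\<^sup>2)) * ennreal ((cmod (Rep_H2 f (Complex r y)))\<^sup>2) \<partial>lborel)"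
    proof (rule nn_integral_mono)
      fix y
      have K: "a\<^sup>2 + (y - Im w)\<^sup>2 > 0" using a by (simp add: add_pos_nonneg)
      have "(cmod (Complex r y - v))\<^sup>2 = a\<^sup>2 + (y - Im w)\<^sup>2"
        by (simp add: v_def cmod_power2)
      then have "(cmod (m (Complex r y)))\<^sup>2
          = (a\<^sup>2 + (y - Im w)\<^sup>2) / (4 * a\<^sup>2 * (cmod (1 + of_real r * Complex r y))\<^sup>2)"
        using a by (simp add: m_def norm_divide norm_mult power_divide power_mult_distrib)
      also have "\<dots> \<le> (a\<^sup>2 + (y - Im w)\<^sup>2) / (4 * a\<^sup>2)"
        using ge(1)[of "Complex r y"] r a K
        by (intro divide_left_mono) (auto simp: one_le_power intro!: mult_pos_pos)
      finally have "(cmod (m (Complex r y)))\<^sup>2 / (a\<^sup>2 + (y - Im w)\<^sup>2) \<le> 1 / (4 * a\<^sup>2)"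
        using K by (simp add: field_simps)
      then have "(cmod (Rep_H2 f (Complex r y)))\<^sup>2 * ((cmod (m (Complex r y)))\<^sup>2 / (a\<^sup>2 + (y - Im w)\<^sup>2))
          \<le> (cmod (Rep_H2 f (Complex r y)))\<^sup>2 * (1 / (4 * a\<^sup>2))"
        by (rule mult_left_mono) simp
      then show "ennreal (cmod (?F (Complex r y)) / (a\<^sup>2 + (y - Im w)\<^sup>2))
         \<le> ennreal (1 / (4 * a\<^sup>2)) * ennreal ((cmod (Rep_H2 f (Complex r y)))\<^sup>2)"
        by (simp add: ennreal_mult'[symmetric] norm_power norm_mult power_mult_distrib)
    qed
    also have "\<dots> = ennreal (1 / (4 * a\<^sup>2)) * (\<integral>\<^sup>+ y. ennreal ((cmod (Rep_H2 f (Complex r y)))\<^sup>2) \<partial>lborel)"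
      by (rule nn_integral_cmult) measurable
    also have "\<dots> \<le> ennreal (1 / (4 * a\<^sup>2)) * ennreal (2 * pi * (norm f)\<^sup>2)"
      using r by (intro mult_left_mono slice_norm_sq_le) auto
    also have "\<dots> = ennreal (1 / (4 * a\<^sup>2) * (2 * pi * (norm f)\<^sup>2))"
      by (rule ennreal_mult'[symmetric]) simp
    finally have "ennreal (pi / a * cmod (?F w)) \<le> ennreal (1 / (4 * a\<^sup>2) * (2 * pi * (norm f)\<^sup>2))"
      using P by (rule order_trans[rotated])
    then have "pi / a * cmod (?F w) \<le> 1 / (4 * a\<^sup>2) * (2 * pi * (norm f)\<^sup>2)"
      by (subst (asm) ennreal_le_iff) simp_all
    moreover have "m w = 1 / (1 + of_real r * w)"
    proof -
      have "w - v = 2 * of_real a" by (simp add: v_def a_def complex_eq_iff)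
      then show ?thesis using a by (simp add: m_def)
    qed
    then have "cmod (?F w) = (cmod (Rep_H2 f w))\<^sup>2 / (cmod (1 + of_real r * w))\<^sup>2"
      by (simp add: norm_power norm_mult norm_divide power_mult_distrib power_divide)
    ultimately show ?thesis
      using a nz[OF w] unfolding a_def[symmetric] by (simp add: field_simps power2_eq_square)
  qed
  \<comment> \<open>Letting \<open>r\<close> tend to 0 removes the damping and moves the line to the
    boundary at once.\<close>
  have "((\<lambda>r. (cmod (1 + of_real r * w))\<^sup>2 * (norm f)\<^sup>2 / (2 * (Re w - r)))
     \<longlongrightarrow> (cmod (1 + of_real 0 * w))\<^sup>2 * (norm f)\<^sup>2 / (2 * (Re w - 0))) (at_right 0)"
    using w by (intro tendsto_intros) auto
  moreover have "\<forall>\<^sub>F r in at_right 0. (cmod (Rep_H2 f w))\<^sup>2 \<le> (cmod (1 + of_real r * w))\<^sup>2 * (norm f)\<^sup>2 / (2 * (Re w - r))"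
    using approx w by (auto simp: eventually_at_right_field)
  ultimately show ?thesis
    by (intro tendsto_lowerbound) auto
qed

text \<open>The Poisson kernel with centre height 0, multiplied by \<open>s^2\<close>, tends to 1
  pointwise as \<open>s\<close> grows, while \<open>poisson_Re_eq\<close> evaluates the weighted
  integral as \<open>pi * s * Re (F (Complex (x + s) 0))\<close>, at most \<open>pi * C\<close>.
  Fatou's lemma passes to the limit.\<close>

lemma nn_integral_Re_line_le:
  fixes F :: "complex \<Rightarrow> complex"
  assumes F: "F holomorphic_on {z. Re z > x0}" and x: "x0 < x"
    and bdd: "\<And>z. Re z \<ge> x \<Longrightarrow> cmod (F z) \<le> B"
    and nonneg: "\<And>y. Re (F (Complex x y)) \<ge> 0"
    and le: "\<And>s. s > 0 \<Longrightarrow> s * Re (F (Complex (x + s) 0)) \<le> C"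
  shows "(\<integral>\<^sup>+ y. ennreal (Re (F (Complex x y))) \<partial>lborel) \<le> ennreal (pi * C)"
proof -
  let ?g = "\<lambda>n y. ennreal ((real (Suc n))\<^sup>2 * (Re (F (Complex x y)) / ((real (Suc n))\<^sup>2 + y\<^sup>2)))"
  have "continuous_on UNIV (\<lambda>y. F (Complex x y))"
    using x by (intro continuous_on_vertical_line[OF holomorphic_on_imp_continuous_on[OF F]]) simp
  then have [measurable]: "(\<lambda>y. F (Complex x y)) \<in> borel_measurable lborel"
    using borel_measurable_continuous_onI by simp
  have "(\<lambda>n. ?g n y) \<longlonglongrightarrow> ennreal (Re (F (Complex x y)))" for y
  proof -
    have "(\<lambda>n. (real (Suc n))\<^sup>2 * (Re (F (Complex x y)) / ((real (Suc n))\<^sup>2 + y\<^sup>2))) \<longlonglongrightarrow> Re (F (Complex x y))"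
      by real_asymp
    then show ?thesis by (intro tendsto_ennrealI)
  qed
  then have "(\<integral>\<^sup>+ y. ennreal (Re (F (Complex x y))) \<partial>lborel) = (\<integral>\<^sup>+ y. liminf (\<lambda>n. ?g n y) \<partial>lborel)"
    by (intro nn_integral_cong lim_imp_Liminf[symmetric]) simp_all
  also have "\<dots> \<le> liminf (\<lambda>n. \<integral>\<^sup>+ y. ?g n y \<partial>lborel)"
    by (rule nn_integral_liminf) measurable
  also have "\<dots> \<le> liminf (\<lambda>n. ennreal (pi * C))"
  proof (intro Liminf_mono always_eventually allI)
    fix n
    let ?s = "real (Suc n)"
    have "(\<integral>\<^sup>+ y. ?g n y \<partial>lborel)
        = (\<integral>\<^sup>+ y. ennreal (?s\<^sup>2) * ennreal (Re (F (Complex x y)) / (?s\<^sup>2 + (y - 0)\<^sup>2)) \<partial>lborel)"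
      by (simp only: ennreal_mult' zero_le_power2 diff_0_right)
    also have "\<dots> = ennreal (?s\<^sup>2) * (\<integral>\<^sup>+ y. ennreal (Re (F (Complex x y)) / (?s\<^sup>2 + (y - 0)\<^sup>2)) \<partial>lborel)"
      by (rule nn_integral_cmult) measurable
    also have "\<dots> = ennreal (?s\<^sup>2) * ennreal (pi / ?s * Re (F (Complex (x + ?s) 0)))"
      by (subst poisson_Re_eq[OF F x _ bdd nonneg]) auto
    also have "\<dots> = ennreal (?s\<^sup>2 * (pi / ?s * Re (F (Complex (x + ?s) 0))))"
      by (rule ennreal_mult'[symmetric]) simp
    also have "?s\<^sup>2 * (pi / ?s * Re (F (Complex (x + ?s) 0))) = pi * (?s * Re (F (Complex (x + ?s) 0)))"
      by (simp add: power2_eq_square del: of_nat_Suc)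
    also have "ennreal \<dots> \<le> ennreal (pi * C)"
      by (intro ennreal_leI mult_left_mono le) auto
    finally show "(\<integral>\<^sup>+ y. ?g n y \<partial>lborel) \<le> ennreal (pi * C)" .
  qed
  also have "\<dots> = ennreal (pi * C)" by (simp add: Liminf_const)
  finally show ?thesis .
qed

section \<open>The upper bound\<close>

lemma Re_inverse_bounds:
  assumes "Re u > 0"
  shows "Re (1 / u) \<ge> 0" "cmod (1 / u) \<le> 1 / Re u"
proof -
  show "Re (1 / u) \<ge> 0" using assms by (simp add: Re_divide)
  show "cmod (1 / u) \<le> 1 / Re u"
    using assms complex_Re_le_cmod[of u] by (simp add: norm_divide frac_le)
qed

lemma Rep_composition_operator:
  assumes "bounded_composition \<phi>"
  shows "Rep_H2 (composition_operator \<phi> f) = compose_H2 \<phi> (Rep_H2 f)"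
  using assms Rep_H2[of f] unfolding bounded_composition_def composition_operator_def
  by (intro Abs_H2_inverse) auto

lemma norm_composition_operator_le:
  assumes hol: "\<phi> holomorphic_on half_plane" and bc: "bounded_composition \<phi>"
    and c: "c > 0" and ge: "\<And>z. z \<in> half_plane \<Longrightarrow> Re (\<phi> z) \<ge> c * Re z"
  shows "norm (composition_operator \<phi> f) \<le> sqrt (1 / c) * norm f"
proof (rule norm_H2_le)
  have "H2_norm_sq (compose_H2 \<phi> (Rep_H2 f)) \<le> ennreal ((norm f)\<^sup>2 / c)"
  proof (rule H2_norm_sq_le_slices)
    fix x :: real assume x: "x > 0"
    \<comment> \<open>\<open>\<phi>\<close> maps the slice at \<open>x\<close> into
      \<open>Re w \<ge> c * x\<close>. Half of that keeps the line of integration at a positive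
      distance from the image, and \<open>\<phi>\<close> still stays to its right on all of
      \<open>Re z > x / 2\<close>.\<close>
    define r where "r = c * x / 2"
    have r: "r > 0" using c x by (simp add: r_def)
    have p: "Re (\<phi> (Complex x' y)) \<ge> c * x'" if "x' > 0" for x' y
      using ge[of "Complex x' y"] that by (simp add: half_plane_def)
    \<comment> \<open>The bound is uniform in \<open>t\<close>, so after exchanging the integrals it
      factors out and leaves a slice integral of \<open>f\<close> on the line
      \<open>Re w = r\<close>.\<close>
    have inner: "(\<integral>\<^sup>+ y. ennreal (Re (1 / (\<phi> (Complex x y) - Complex r t))) \<partial>lborel) \<le> ennreal (pi * (1 / c))" for t
    proof (rule nn_integral_Re_line_le)
      have pos: "Re (\<phi> z - Complex r t) \<ge> c * (Re z - x / 2)" if "Re z > 0" for z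
        using ge[of z] that by (simp add: half_plane_def r_def algebra_simps)
      show "(\<lambda>z. 1 / (\<phi> z - Complex r t)) holomorphic_on {z. Re z > x / 2}"
      proof (intro holomorphic_intros holomorphic_on_subset[OF hol])
        show "{z. x / 2 < Re z} \<subseteq> half_plane" using x by (auto simp: half_plane_def)
        fix z assume z: "z \<in> {z. x / 2 < Re z}"
        then have "0 < c * (Re z - x / 2)" using c by simp
        also have "\<dots> \<le> Re (\<phi> z - Complex r t)" using z x by (intro pos) auto
        finally show "\<phi> z - Complex r t \<noteq> 0" by auto
      qed
      show "x / 2 < x" using x by simp
      show "cmod (1 / (\<phi> z - Complex r t)) \<le> 1 / (c * (x / 2))" if z: "Re z \<ge> x" for z
      proof -
        have "0 < c * (x / 2)" using c x by simp
        moreover have "c * (x / 2) \<le> c * (Re z - x / 2)" using z c by simp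
        moreover have "\<dots> \<le> Re (\<phi> z - Complex r t)" using z x by (intro pos) auto
        ultimately show ?thesis
          using Re_inverse_bounds(2)[of "\<phi> z - Complex r t"]
          by (intro order_trans[OF Re_inverse_bounds(2)] frac_le) auto
      qed
      show "0 \<le> Re (1 / (\<phi> (Complex x y) - Complex r t))" for y
      proof (rule Re_inverse_bounds(1))
        have "0 < c * (x - x / 2)" using c x by simp
        also have "\<dots> \<le> Re (\<phi> (Complex x y) - Complex r t)" using pos[of "Complex x y"] x by simp
        finally show "0 < Re (\<phi> (Complex x y) - Complex r t)" .
      qed
      show "s * Re (1 / (\<phi> (Complex (x + s) 0) - Complex r t)) \<le> 1 / c" if s: "s > 0" for s
      proof -
        let ?u = "\<phi> (Complex (x + s) 0) - Complex r t"
        have "c * s \<le> c * (x + s - x / 2)" using c x by simp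
        also have "\<dots> \<le> Re ?u" using pos[of "Complex (x + s) 0"] x s by simp
        finally have u: "c * s \<le> Re ?u" .
        have cs: "c * s > 0" using c s by simp
        have "Re (1 / ?u) \<le> cmod (1 / ?u)" by (rule complex_Re_le_cmod)
        also have "\<dots> \<le> 1 / Re ?u" using u cs by (intro Re_inverse_bounds(2)) simp
        also have "\<dots> \<le> 1 / (c * s)" using u cs by (intro frac_le) auto
        finally have "s * Re (1 / ?u) \<le> s * (1 / (c * s))" using s by (intro mult_left_mono) auto
        then show ?thesis using s by simp
      qed
    qed
    note [measurable] = slice_measurable(2)[OF hol x] slice_measurable(2)[OF Rep_H2_holomorphic[of f] r]
    have "continuous_on UNIV (Complex r)" unfolding Complex_eq by (intro continuous_intros)
    then have [measurable]: "Complex r \<in> borel_measurable borel" by (rule borel_measurable_continuous_onI)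
    have "continuous_on half_plane (\<lambda>z. Rep_H2 f (\<phi> z))"
    proof (rule continuous_on_compose2[OF _ holomorphic_on_imp_continuous_on[OF hol]])
      show "continuous_on half_plane (Rep_H2 f)"
        using Rep_H2_holomorphic holomorphic_on_imp_continuous_on by blast
      show "\<phi> ` half_plane \<subseteq> half_plane"
      proof
        fix w assume "w \<in> \<phi> ` half_plane"
        then obtain z where z: "z \<in> half_plane" "w = \<phi> z" by blast
        then have "0 < c * Re z" using c by (simp add: half_plane_def)
        then show "w \<in> half_plane" using ge[OF z(1)] z(2) by (simp add: half_plane_def)
      qed
    qed
    then have "continuous_on UNIV (\<lambda>y. Rep_H2 f (\<phi> (Complex x y)))"
      by (rule continuous_on_compose2[where f = "Complex x"])
        (use x in \<open>auto simp: half_plane_def Complex_eq intro!: continuous_intros\<close>)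
    then have [measurable]: "(\<lambda>y. Rep_H2 f (\<phi> (Complex x y))) \<in> borel_measurable borel"
      by (rule borel_measurable_continuous_onI)
    let ?I = "\<integral>\<^sup>+ y. ennreal ((cmod (Rep_H2 f (\<phi> (Complex x y))))\<^sup>2) \<partial>lborel"
    have "ennreal pi * ?I = (\<integral>\<^sup>+ y. ennreal (pi * (cmod (Rep_H2 f (\<phi> (Complex x y))))\<^sup>2) \<partial>lborel)"
      by (subst nn_integral_cmult[symmetric]) (auto simp: ennreal_mult')
    also have "\<dots> \<le> (\<integral>\<^sup>+ y. \<integral>\<^sup>+ t. ennreal ((cmod (Rep_H2 f (Complex r t)))\<^sup>2 *
          Re (1 / (\<phi> (Complex x y) - Complex r t))) \<partial>lborel \<partial>lborel)"
    proof (intro nn_integral_mono H2_subharmonic r)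
      fix y
      have "r < c * x" using c x by (simp add: r_def)
      also have "\<dots> \<le> Re (\<phi> (Complex x y))" using x by (rule p)
      finally show "r < Re (\<phi> (Complex x y))" .
    qed
    also have "\<dots> = (\<integral>\<^sup>+ t. \<integral>\<^sup>+ y. ennreal ((cmod (Rep_H2 f (Complex r t)))\<^sup>2 *
          Re (1 / (\<phi> (Complex x y) - Complex r t))) \<partial>lborel \<partial>lborel)"
      by (rule lborel_pair.Fubini') measurable
    also have "\<dots> = (\<integral>\<^sup>+ t. ennreal ((cmod (Rep_H2 f (Complex r t)))\<^sup>2) *
        (\<integral>\<^sup>+ y. ennreal (Re (1 / (\<phi> (Complex x y) - Complex r t))) \<partial>lborel) \<partial>lborel)"
      by (intro nn_integral_cong, subst nn_integral_cmult[symmetric]) (auto simp: ennreal_mult')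
    also have "\<dots> \<le> (\<integral>\<^sup>+ t. ennreal ((cmod (Rep_H2 f (Complex r t)))\<^sup>2) * ennreal (pi * (1 / c)) \<partial>lborel)"
      by (intro nn_integral_mono mult_left_mono inner) auto
    also have "\<dots> = (\<integral>\<^sup>+ t. ennreal ((cmod (Rep_H2 f (Complex r t)))\<^sup>2) \<partial>lborel) * ennreal (pi * (1 / c))"
      by (rule nn_integral_multc) measurable
    also have "\<dots> \<le> ennreal (2 * pi * (norm f)\<^sup>2) * ennreal (pi * (1 / c))"
      using r by (intro mult_right_mono slice_norm_sq_le) auto
    finally have "ennreal (1 / pi) * (ennreal pi * ?I) \<le> ennreal (1 / pi) * (ennreal (2 * pi * (norm f)\<^sup>2) * ennreal (pi * (1 / c)))"
      by (rule mult_left_mono) simp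
    then have "?I \<le> ennreal (2 * pi * ((norm f)\<^sup>2 / c))"
      using c by (simp add: mult.assoc[symmetric] ennreal_mult'[symmetric] ennreal_mult''[symmetric]) (simp add: mult_ac)
    then show "(\<integral>\<^sup>+ y. ennreal ((cmod (compose_H2 \<phi> (Rep_H2 f) (Complex x y)))\<^sup>2) \<partial>lborel) \<le> ennreal (2 * pi * ((norm f)\<^sup>2 / c))"
      using x by (simp add: compose_H2_def half_plane_def)
  qed (use c in auto)
  then show "H2_norm_sq (Rep_H2 (composition_operator \<phi> f)) \<le> ennreal ((sqrt (1 / c) * norm f)\<^sup>2)"
    using c by (simp add: Rep_composition_operator[OF bc] power_mult_distrib)
qed (use c in auto)

section \<open>The angular derivative at infinity\<close>

text \<open>Cayley transforms centred at \<open>z0\<close> and at \<open>\<psi> z0\<close> turn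
  \<open>\<psi>\<close> into a self-map \<open>g\<close> of the unit disc fixing 0, to which the
  Schwarz lemma applies; \<open>A\<close> is the inverse of the first transform.\<close>

lemma schwarz_pick_half_plane:
  assumes hol: "\<psi> holomorphic_on half_plane" and maps: "\<And>z. z \<in> half_plane \<Longrightarrow> \<psi> z \<in> half_plane"
    and z: "z \<in> half_plane" and z0: "z0 \<in> half_plane"
  shows "cmod (\<psi> z - \<psi> z0) * cmod (z + cnj z0) \<le> cmod (z - z0) * cmod (\<psi> z + cnj (\<psi> z0))"
proof -
  define A where "A = (\<lambda>\<zeta>. (z0 + cnj z0 * \<zeta>) / (1 - \<zeta>))"
  define g where "g = (\<lambda>\<zeta>. (\<psi> (A \<zeta>) - \<psi> z0) / (\<psi> (A \<zeta>) + cnj (\<psi> z0)))"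
  have cayley: "cmod (u - u0) < cmod (u + cnj u0)" if "u \<in> half_plane" "u0 \<in> half_plane" for u u0
  proof -
    have "(cmod (u + cnj u0))\<^sup>2 - (cmod (u - u0))\<^sup>2 = 4 * (Re u * Re u0)"
      unfolding cmod_power2 by (simp add: power2_eq_square algebra_simps)
    moreover have "Re u * Re u0 > 0" using that by (simp add: half_plane_def)
    ultimately have "(cmod (u - u0))\<^sup>2 < (cmod (u + cnj u0))\<^sup>2" by linarith
    then show ?thesis by (rule power2_less_imp_less) simp
  qed
  have nz: "u + cnj u0 \<noteq> 0" if "u \<in> half_plane" "u0 \<in> half_plane" for u u0
    using cayley[OF that] by auto
  have A: "A \<zeta> \<in> half_plane" if "cmod \<zeta> < 1" for \<zeta>
  proof -
    have "\<zeta> \<noteq> 1" using that by auto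
    then have "Re (1 - \<zeta>) \<noteq> 0 \<or> Im (1 - \<zeta>) \<noteq> 0" by (auto simp: complex_eq_iff)
    then have "(Re (1 - \<zeta>))\<^sup>2 + (Im (1 - \<zeta>))\<^sup>2 > 0"
      by (simp only: sum_power2_gt_zero_iff)
    moreover have "Re (A \<zeta>) = Re z0 * (1 - (cmod \<zeta>)\<^sup>2) / ((Re (1 - \<zeta>))\<^sup>2 + (Im (1 - \<zeta>))\<^sup>2)"
      unfolding A_def Re_divide cmod_power2 by (simp add: power2_eq_square algebra_simps)
    moreover have "(cmod \<zeta>)\<^sup>2 < 1" using that by (simp add: power_less_one_iff abs_square_less_1)
    moreover have "Re z0 > 0" using z0 by (simp add: half_plane_def)
    ultimately show ?thesis unfolding half_plane_def by simp
  qed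
  have "g holomorphic_on ball 0 1"
  proof -
    have "A holomorphic_on ball 0 1"
      unfolding A_def by (intro holomorphic_intros) auto
    then have "(\<psi> \<circ> A) holomorphic_on ball 0 1"
      by (rule holomorphic_on_compose_gen[OF _ hol]) (use A in auto)
    then have "(\<lambda>\<zeta>. \<psi> (A \<zeta>)) holomorphic_on ball 0 1" by (simp add: o_def)
    then show ?thesis
      unfolding g_def using A maps nz z0 by (intro holomorphic_intros) auto
  qed
  moreover have "g 0 = 0" by (simp add: g_def A_def)
  moreover have "cmod (g \<zeta>) < 1" if "cmod \<zeta> < 1" for \<zeta>
    using cayley[OF maps[OF A[OF that]] maps[OF z0]] nz[OF maps[OF A[OF that]] maps[OF z0]]
    by (simp add: g_def norm_divide)
  moreover have zeta: "cmod ((z - z0) / (z + cnj z0)) < 1"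
    using cayley[OF z z0] nz[OF z z0] by (simp add: norm_divide)
  ultimately have le: "cmod (g ((z - z0) / (z + cnj z0))) \<le> cmod ((z - z0) / (z + cnj z0))"
    by (intro Schwarz_Lemma(1)) auto
  have "A ((z - z0) / (z + cnj z0)) = z"
  proof -
    have n: "z + cnj z0 \<noteq> 0" "z0 + cnj z0 \<noteq> 0" using nz z z0 by auto
    have "z0 + cnj z0 * ((z - z0) / (z + cnj z0)) = z * (z0 + cnj z0) / (z + cnj z0)"
      using n by (simp add: field_simps)
    moreover have "1 - (z - z0) / (z + cnj z0) = (z0 + cnj z0) / (z + cnj z0)"
      using n by (simp add: field_simps)
    ultimately show ?thesis using n by (simp add: A_def)
  qed
  with le have "cmod (\<psi> z - \<psi> z0) / cmod (\<psi> z + cnj (\<psi> z0)) \<le> cmod (z - z0) / cmod (z + cnj z0)"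
    by (simp add: g_def norm_divide)
  moreover have "cmod (\<psi> z + cnj (\<psi> z0)) > 0" "cmod (z + cnj z0) > 0"
    using nz[OF z z0] nz[OF maps[OF z] maps[OF z0]] by auto
  ultimately show ?thesis by (simp add: field_simps)
qed

text \<open>A single point where the ratio of real parts is at most \<open>e\<close> controls the
  growth of \<open>\<psi>\<close> on the whole positive axis. With \<open>id\<close>, the squared
  Schwarz-Pick inequality becomes
  \<open>P * x * Re z0 \<le> Q * Re (\<psi> X) * Re (\<psi> z0)\<close>; bounding
  \<open>Re (\<psi> X)\<close> by the square root of \<open>P\<close> lets one factor
  cancel.\<close>

lemma julia_half_plane:
  assumes hol: "\<psi> holomorphic_on half_plane" and maps: "\<And>z. z \<in> half_plane \<Longrightarrow> \<psi> z \<in> half_plane"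
    and z0: "z0 \<in> half_plane" and x: "x > 0" and le: "Re (\<psi> z0) \<le> e * Re z0"
  shows "cmod (\<psi> (of_real x) + cnj (\<psi> z0)) \<le> e * (cmod (of_real x + cnj z0))\<^sup>2 / x"
proof -
  define X where "X = complex_of_real x"
  have X: "X \<in> half_plane" using x by (simp add: X_def half_plane_def)
  have pos: "Re (\<psi> X) > 0" "Re (\<psi> z0) > 0" "Re z0 > 0"
    using maps[OF X] maps[OF z0] z0 by (auto simp: half_plane_def)
  have id: "(cmod (u - u0))\<^sup>2 = (cmod (u + cnj u0))\<^sup>2 - 4 * (Re u * Re u0)" for u u0
    unfolding cmod_power2 by (simp add: power2_eq_square algebra_simps)
  define P where "P = (cmod (\<psi> X + cnj (\<psi> z0)))\<^sup>2"
  define Q where "Q = (cmod (X + cnj z0))\<^sup>2"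
  have "(cmod (\<psi> X - \<psi> z0) * cmod (X + cnj z0))\<^sup>2 \<le> (cmod (X - z0) * cmod (\<psi> X + cnj (\<psi> z0)))\<^sup>2"
    by (intro power_mono schwarz_pick_half_plane[OF hol maps X z0]) auto
  then have "(P - 4 * (Re (\<psi> X) * Re (\<psi> z0))) * Q \<le> (Q - 4 * (Re X * Re z0)) * P"
    unfolding power_mult_distrib id P_def Q_def .
  then have "P * (x * Re z0) \<le> Q * (Re (\<psi> X) * Re (\<psi> z0))"
    by (simp add: algebra_simps X_def)
  also have "\<dots> \<le> Q * (Re (\<psi> X) * (e * Re z0))"
    using le pos by (intro mult_left_mono) (auto simp: Q_def)
  finally have "P * x * Re z0 \<le> Q * e * Re (\<psi> X) * Re z0"
    by (simp add: mult_ac)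
  then have "P * x \<le> Q * e * Re (\<psi> X)"
    using pos by simp
  also have "\<dots> \<le> Q * e * cmod (\<psi> X + cnj (\<psi> z0))"
  proof (rule mult_left_mono)
    show "Re (\<psi> X) \<le> cmod (\<psi> X + cnj (\<psi> z0))"
      using complex_Re_le_cmod[of "\<psi> X + cnj (\<psi> z0)"] pos by simp
    have "e * Re z0 > 0" using le pos by linarith
    then have "e > 0" using pos by (simp add: zero_less_mult_iff)
    then show "0 \<le> Q * e" by (simp add: Q_def)
  qed
  finally have "cmod (\<psi> X + cnj (\<psi> z0)) * (cmod (\<psi> X + cnj (\<psi> z0)) * x) \<le> cmod (\<psi> X + cnj (\<psi> z0)) * (e * Q)"
    by (simp add: P_def power2_eq_square mult_ac)
  moreover have "Re (\<psi> X) + Re (\<psi> z0) \<le> cmod (\<psi> X + cnj (\<psi> z0))"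
    using complex_Re_le_cmod[of "\<psi> X + cnj (\<psi> z0)"] by simp
  then have "cmod (\<psi> X + cnj (\<psi> z0)) > 0" using pos by linarith
  ultimately have "cmod (\<psi> X + cnj (\<psi> z0)) * x \<le> e * Q"
    by (simp only: mult_le_cancel_left_pos)
  then show ?thesis
    using x by (simp add: X_def Q_def field_simps)
qed

text \<open>Subtracting \<open>c * z\<close> leaves a nonnegative real part, and adding
  \<open>e * z\<close> makes it positive, so \<open>\<psi>\<close> is again a self-map. A
  near-minimiser \<open>z0\<close> of the ratio satisfies the hypothesis of
  \<open>julia_half_plane\<close> with \<open>2 * e\<close>, which makes
  \<open>\<phi> x - c * x\<close> of order \<open>e * x\<close>.\<close>

lemma angular_derivative_at_infinity:
  assumes hol: "\<phi> holomorphic_on half_plane"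
    and c: "\<And>z. z \<in> half_plane \<Longrightarrow> Re (\<phi> z) \<ge> c * Re z"
    and inf: "\<And>e. e > 0 \<Longrightarrow> \<exists>z\<in>half_plane. Re (\<phi> z) \<le> (c + e) * Re z"
  shows "((\<lambda>x. \<phi> (of_real x) / of_real x) \<longlongrightarrow> of_real c) at_top"
proof (rule tendstoI)
  fix e0 :: real assume "e0 > 0"
  \<comment> \<open>The final bound tends to \<open>2 * e + e = e0 / 2\<close>, strictly below
    \<open>e0\<close>.\<close>
  define e where "e = e0 / 6"
  have e: "e > 0" using \<open>e0 > 0\<close> by (simp add: e_def)
  define \<psi> where "\<psi> = (\<lambda>z. \<phi> z - of_real c * z + of_real e * z)"
  have h\<psi>: "\<psi> holomorphic_on half_plane"
    unfolding \<psi>_def by (intro holomorphic_intros hol)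
  have m\<psi>: "\<psi> z \<in> half_plane" if "z \<in> half_plane" for z
    using c[OF that] that mult_pos_pos[OF e, of "Re z"] unfolding \<psi>_def half_plane_def
    by simp
  obtain z0 where z0: "z0 \<in> half_plane" "Re (\<phi> z0) \<le> (c + e) * Re z0"
    using inf[OF e] by blast
  then have le: "Re (\<psi> z0) \<le> (2 * e) * Re z0"
    by (simp add: \<psi>_def algebra_simps)
  have "((\<lambda>x. 2 * e * (1 + cmod z0 / x)\<^sup>2 + cmod (\<psi> z0) / x + e) \<longlongrightarrow> 2 * e * (1 + 0)\<^sup>2 + 0 + e) at_top"
    by (intro tendsto_add tendsto_mult tendsto_power tendsto_const filterlim_ident
        real_tendsto_divide_at_top[OF tendsto_const])
  then have "\<forall>\<^sub>F x in at_top. 2 * e * (1 + cmod z0 / x)\<^sup>2 + cmod (\<psi> z0) / x + e < e0"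
    by (rule order_tendstoD) (use e in \<open>simp add: e_def\<close>)
  then show "\<forall>\<^sub>F x in at_top. dist (\<phi> (of_real x) / of_real x) (of_real c) < e0"
    using eventually_gt_at_top[of 0]
  proof eventually_elim
    fix x :: real
    assume small: "2 * e * (1 + cmod z0 / x)\<^sup>2 + cmod (\<psi> z0) / x + e < e0" and x: "0 < x"
    have "cmod (of_real x + cnj z0) \<le> x * (1 + cmod z0 / x)"
      using norm_triangle_ineq[of "of_real x" "cnj z0"] x by (simp add: distrib_left)
    then have "(cmod (of_real x + cnj z0))\<^sup>2 \<le> (x * (1 + cmod z0 / x))\<^sup>2"
      by (rule power_mono) simp
    then have "2 * e * (cmod (of_real x + cnj z0))\<^sup>2 / x \<le> 2 * e * (x * (1 + cmod z0 / x))\<^sup>2 / x"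
      using e x by (intro divide_right_mono mult_left_mono) auto
    also have "\<dots> = x * (2 * e * (1 + cmod z0 / x)\<^sup>2)"
      using x by (simp add: power_mult_distrib power2_eq_square)
    finally have "cmod (\<psi> (of_real x) + cnj (\<psi> z0)) \<le> x * (2 * e * (1 + cmod z0 / x)\<^sup>2)"
      using julia_half_plane[OF h\<psi> m\<psi> z0(1) x le] by linarith
    then have "cmod (\<psi> (of_real x)) \<le> x * (2 * e * (1 + cmod z0 / x)\<^sup>2) + cmod (\<psi> z0)"
      using norm_triangle_ineq4[of "\<psi> (of_real x) + cnj (\<psi> z0)" "cnj (\<psi> z0)"] by simp
    moreover have "\<phi> (of_real x) - of_real c * of_real x = \<psi> (of_real x) - of_real e * of_real x"
      by (simp add: \<psi>_def)
    then have "cmod (\<phi> (of_real x) - of_real c * of_real x) \<le> cmod (\<psi> (of_real x)) + e * x"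
      using norm_triangle_ineq4[of "\<psi> (of_real x)" "of_real e * of_real x"] e x by (simp add: norm_mult)
    ultimately have "cmod (\<phi> (of_real x) - of_real c * of_real x)
        \<le> x * (2 * e * (1 + cmod z0 / x)\<^sup>2 + cmod (\<psi> z0) / x + e)"
      using x by (simp add: algebra_simps)
    also have "\<dots> < x * e0" using small x by simp
    finally have "cmod (\<phi> (of_real x) - of_real c * of_real x) / x < e0"
      using x by (simp add: field_simps)
    moreover have "\<phi> (of_real x) / of_real x - of_real c = (\<phi> (of_real x) - of_real c * of_real x) / of_real x"
      using x by (simp add: field_simps)
    ultimately show "dist (\<phi> (of_real x) / of_real x) (of_real c) < e0"
      using x by (simp add: dist_norm norm_divide)
  qed
qed

section \<open>Reproducing kernels\<close>

text \<open>The reproducing kernel at \<open>p\<close>; the factor \<open>1 / (2 * pi)\<close> in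
  the norm makes its numerator 1.\<close>

definition hardy_kernel :: "complex \<Rightarrow> H2" where
  "hardy_kernel p = Abs_H2 (\<lambda>z. if z \<in> half_plane then 1 / (z + cnj p) else 0)"

lemma H2_norm_sq_hardy_kernel:
  assumes p: "Re p > 0"
  shows "H2_norm_sq (\<lambda>z. if z \<in> half_plane then 1 / (z + cnj p) else 0) \<le> ennreal (1 / (2 * Re p))"
proof (rule H2_norm_sq_le_slices)
  fix x :: real assume x: "x > 0"
  have "(cmod (if Complex x y \<in> half_plane then 1 / (Complex x y + cnj p) else 0))\<^sup>2
      = 1 / ((x + Re p)\<^sup>2 + (y - Im p)\<^sup>2)" for y
    using x by (simp add: half_plane_def norm_divide power_divide cmod_power2)
  then have "(\<integral>\<^sup>+ y. ennreal ((cmod (if Complex x y \<in> half_plane then 1 / (Complex x y + cnj p) else 0))\<^sup>2) \<partial>lborel)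
      = ennreal (pi / (x + Re p))"
    using x p nn_integral_cauchy_kernel[of "x + Re p" "Im p"] by simp
  also have "\<dots> \<le> ennreal (2 * pi * (1 / (2 * Re p)))"
    using x p by (intro ennreal_leI) (simp add: frac_le)
  finally show "(\<integral>\<^sup>+ y. ennreal ((cmod (if Complex x y \<in> half_plane then 1 / (Complex x y + cnj p) else 0))\<^sup>2) \<partial>lborel)
      \<le> ennreal (2 * pi * (1 / (2 * Re p)))" .
qed (use p in auto)

lemma Rep_hardy_kernel:
  assumes p: "Re p > 0"
  shows "Rep_H2 (hardy_kernel p) = (\<lambda>z. if z \<in> half_plane then 1 / (z + cnj p) else 0)"
  unfolding hardy_kernel_def
proof (rule Abs_H2_inverse)
  let ?k = "\<lambda>z. if z \<in> half_plane then 1 / (z + cnj p) else 0"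
  have "z + cnj p \<noteq> 0" if "z \<in> half_plane" for z
  proof -
    have "Re (z + cnj p) > 0" using that p by (simp add: half_plane_def)
    then show ?thesis by (metis less_irrefl zero_complex.sel(1))
  qed
  then have "(\<lambda>z. 1 / (z + cnj p)) holomorphic_on half_plane"
    by (intro holomorphic_intros) auto
  then have "?k holomorphic_on half_plane"
    by (rule holomorphic_transform) simp
  moreover have "H2_norm_sq ?k < \<infinity>"
    using H2_norm_sq_hardy_kernel[OF p] by (rule le_less_trans) simp
  ultimately show "?k \<in> H2_set" by (simp add: H2_set_def)
qed

lemma norm_hardy_kernel_le:
  assumes p: "Re p > 0"
  shows "norm (hardy_kernel p) \<le> sqrt (1 / (2 * Re p))"
  by (rule norm_H2_le) (use p H2_norm_sq_hardy_kernel[OF p] in \<open>simp_all add: Rep_hardy_kernel\<close>)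

lemma Rep_H2_sum_scaleR:
  assumes "finite I"
  shows "Rep_H2 (\<Sum>i\<in>I. c i *\<^sub>R f i) z = (\<Sum>i\<in>I. of_real (c i) * Rep_H2 (f i) z)"
  using assms by induction (simp_all add: zero_H2.rep_eq plus_H2.rep_eq scaleR_H2.rep_eq)

text \<open>By partial fractions, the real part of \<open>1 / ((a + i y) (b - i y))\<close> is the sum of two Poisson
  kernels divided by \<open>a + b\<close>.\<close>

lemma has_bochner_integral_kernel_product:
  fixes a b :: real
  assumes a: "a > 0" and b: "b > 0"
  shows "has_bochner_integral lborel (\<lambda>y. Re (1 / Complex a y * cnj (1 / Complex b y))) (2 * pi / (a + b))"
proof -
  have "Re (1 / Complex a y * cnj (1 / Complex b y))
      = (a * (1 / (a\<^sup>2 + (y - 0)\<^sup>2)) + b * (1 / (b\<^sup>2 + (y - 0)\<^sup>2))) / (a + b)" for y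
  proof -
    have nz: "a\<^sup>2 + y\<^sup>2 \<noteq> 0" "b\<^sup>2 + y\<^sup>2 \<noteq> 0" "a + b \<noteq> 0"
      using a b by (simp_all add: add_pos_nonneg less_imp_neq[symmetric])
    have "Re (1 / Complex a y * cnj (1 / Complex b y)) = (a * b + y * y) / ((a\<^sup>2 + y\<^sup>2) * (b\<^sup>2 + y\<^sup>2))"
    proof -
      have mult: "Re (u * cnj v) = Re u * Re v + Im u * Im v" for u v by simp
      have "Re (1 / Complex d y) = d / (d\<^sup>2 + y\<^sup>2)" "Im (1 / Complex d y) = - y / (d\<^sup>2 + y\<^sup>2)" for d
        by (simp_all add: Re_divide Im_divide)
      then show ?thesis
        unfolding mult by (simp add: add_divide_distrib)
    qed
    also have "\<dots> = (a * (1 / (a\<^sup>2 + y\<^sup>2)) + b * (1 / (b\<^sup>2 + y\<^sup>2))) / (a + b)"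
    proof -
      have "(a * b + y * y) * (a + b) = a * (b\<^sup>2 + y\<^sup>2) + b * (a\<^sup>2 + y\<^sup>2)"
        by (simp add: power2_eq_square algebra_simps)
      then show ?thesis using nz by (simp add: divide_simps)
    qed
    finally show ?thesis by simp
  qed
  moreover have "has_bochner_integral lborel
     (\<lambda>y. (a * (1 / (a\<^sup>2 + (y - 0)\<^sup>2)) + b * (1 / (b\<^sup>2 + (y - 0)\<^sup>2))) / (a + b))
     ((a * (pi / a) + b * (pi / b)) / (a + b))"
    using a b
    by (intro has_bochner_integral_divide has_bochner_integral_add has_bochner_integral_mult_right
        has_bochner_integral_cauchy_kernel) auto
  ultimately show ?thesis using a b by simp
qed

text \<open>\<open>1 / (a i + a j)\<close> is the inner product of the two kernels. On the slice at
  \<open>x\<close> the sum of kernels has the same expansion with both points shifted by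
  \<open>x\<close>; as the coefficients are nonnegative, the shift only decreases each term.\<close>

lemma norm_sum_hardy_kernel_le:
  assumes I: "finite I" and c: "\<And>i. i \<in> I \<Longrightarrow> c i \<ge> 0" and a: "\<And>i. i \<in> I \<Longrightarrow> a i > 0"
  shows "(norm (\<Sum>i\<in>I. c i *\<^sub>R hardy_kernel (of_real (a i))))\<^sup>2 \<le> (\<Sum>i\<in>I. \<Sum>j\<in>I. c i * c j / (a i + a j))"
proof -
  let ?f = "\<Sum>i\<in>I. c i *\<^sub>R hardy_kernel (of_real (a i))"
  let ?C = "\<Sum>i\<in>I. \<Sum>j\<in>I. c i * c j / (a i + a j)"
  have C: "?C \<ge> 0"
    using c a by (intro sum_nonneg divide_nonneg_nonneg mult_nonneg_nonneg) (auto intro: add_nonneg_nonneg less_imp_le)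
  have "H2_norm_sq (Rep_H2 ?f) \<le> ennreal ?C"
  proof (rule H2_norm_sq_le_slices)
    fix x :: real assume x: "x > 0"
    have sq: "(cmod (Rep_H2 ?f (Complex x y)))\<^sup>2 = (\<Sum>i\<in>I. \<Sum>j\<in>I. c i * c j *
        Re (1 / Complex (x + a i) y * cnj (1 / Complex (x + a j) y)))" for y
    proof -
      have "Rep_H2 ?f (Complex x y) = (\<Sum>i\<in>I. of_real (c i) * (1 / Complex (x + a i) y))"
        unfolding Rep_H2_sum_scaleR[OF I]
      proof (intro sum.cong refl)
        fix i assume "i \<in> I"
        moreover have "Complex x y + of_real (a i) = Complex (x + a i) y" by (simp add: complex_eq_iff)
        ultimately show "of_real (c i) * Rep_H2 (hardy_kernel (of_real (a i))) (Complex x y)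
            = of_real (c i) * (1 / Complex (x + a i) y)"
          using a x by (simp add: Rep_hardy_kernel half_plane_def)
      qed
      moreover have "(cmod S)\<^sup>2 = Re (S * cnj S)" for S
        unfolding cmod_power2 by (simp add: power2_eq_square)
      ultimately have "(cmod (Rep_H2 ?f (Complex x y)))\<^sup>2 = Re ((\<Sum>i\<in>I. of_real (c i) * (1 / Complex (x + a i) y)) *
          cnj (\<Sum>j\<in>I. of_real (c j) * (1 / Complex (x + a j) y)))"
        by (simp only:)
      also have "\<dots> = Re (\<Sum>i\<in>I. \<Sum>j\<in>I. of_real (c i * c j) *
          (1 / Complex (x + a i) y * cnj (1 / Complex (x + a j) y)))"
        by (simp only: cnj_sum complex_cnj_mult complex_cnj_complex_of_real sum_product of_real_mult mult_ac)
      also have "\<dots> = (\<Sum>i\<in>I. \<Sum>j\<in>I. c i * c j * Re (1 / Complex (x + a i) y * cnj (1 / Complex (x + a j) y)))"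
        by (simp only: Re_sum times_complex.sel(1)[of "of_real _"] Re_complex_of_real Im_complex_of_real
            mult_zero_left diff_0_right)
      finally show ?thesis .
    qed
    have hb: "has_bochner_integral lborel (\<lambda>y. (cmod (Rep_H2 ?f (Complex x y)))\<^sup>2)
       (\<Sum>i\<in>I. \<Sum>j\<in>I. c i * c j * (2 * pi / ((x + a i) + (x + a j))))"
      unfolding sq using a x
      by (intro has_bochner_integral_sum has_bochner_integral_mult_right has_bochner_integral_kernel_product)
        (auto intro: add_pos_pos)
    then have "(\<integral>\<^sup>+ y. ennreal ((cmod (Rep_H2 ?f (Complex x y)))\<^sup>2) \<partial>lborel)
       = ennreal (\<Sum>i\<in>I. \<Sum>j\<in>I. c i * c j * (2 * pi / ((x + a i) + (x + a j))))"
      unfolding has_bochner_integral_iff by (subst nn_integral_eq_integral) auto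
    also have "\<dots> \<le> ennreal (\<Sum>i\<in>I. \<Sum>j\<in>I. 2 * pi * (c i * c j / (a i + a j)))"
    proof (intro ennreal_leI sum_mono)
      fix i j assume ij: "i \<in> I" "j \<in> I"
      have "2 * pi / ((x + a i) + (x + a j)) \<le> 2 * pi / (a i + a j)"
        using a[OF ij(1)] a[OF ij(2)] x by (intro divide_left_mono) (auto intro!: mult_pos_pos)
      then have "c i * c j * (2 * pi / ((x + a i) + (x + a j))) \<le> c i * c j * (2 * pi / (a i + a j))"
        using c ij by (intro mult_left_mono) auto
      then show "c i * c j * (2 * pi / ((x + a i) + (x + a j))) \<le> 2 * pi * (c i * c j / (a i + a j))"
        by (simp add: mult_ac)
    qed
    also have "(\<Sum>i\<in>I. \<Sum>j\<in>I. 2 * pi * (c i * c j / (a i + a j))) = 2 * pi * ?C"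
      by (simp only: sum_distrib_left)
    finally show "(\<integral>\<^sup>+ y. ennreal ((cmod (Rep_H2 ?f (Complex x y)))\<^sup>2) \<partial>lborel) \<le> ennreal (2 * pi * ?C)" .
  qed (rule C)
  then have "norm ?f \<le> sqrt ?C"
    using C by (intro norm_H2_le) auto
  then have "(norm ?f)\<^sup>2 \<le> (sqrt ?C)\<^sup>2" by (rule power_mono) simp
  then show ?thesis using C by simp
qed

text \<open>The factor is the reciprocal of the norm of the kernel at \<open>4 ^ n\<close>.
  Geometric spacing of the points makes the inner products decay geometrically, and base 4 keeps the
  square roots powers of 2.\<close>

definition lacunary_kernel :: "nat \<Rightarrow> H2" where
  "lacunary_kernel n = sqrt (2 * 4 ^ n) *\<^sub>R hardy_kernel (of_real (4 ^ n))"

lemma norm_lacunary_kernel_le: "norm (lacunary_kernel n) \<le> 1"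
proof -
  have "norm (lacunary_kernel n) \<le> sqrt (2 * 4 ^ n) * sqrt (1 / (2 * Re (of_real (4 ^ n))))"
    unfolding lacunary_kernel_def norm_scaleR
    by (intro mult_mono norm_hardy_kernel_le) (auto simp del: of_real_power)
  also have "\<dots> = 1"
    by (simp add: real_sqrt_mult[symmetric] del: of_real_power)
  finally show ?thesis .
qed

text \<open>The lacunary kernels are nearly orthonormal: their Gram matrix has entries at most
  \<open>2 * (1/2) ^ |m - n|\<close>.\<close>

lemma norm_sum_lacunary_kernel_le:
  assumes I: "finite I"
  shows "(norm (\<Sum>n\<in>I. lacunary_kernel n))\<^sup>2 \<le> 8 * card I"
proof -
  have half: "(\<Sum>m\<in>J. (1 / 2 :: real) ^ d m) \<le> 2" if "finite J" "inj_on d J" for J and d :: "nat \<Rightarrow> nat"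
  proof -
    have "(\<Sum>m\<in>J. (1 / 2 :: real) ^ d m) = (\<Sum>k\<in>d ` J. (1 / 2) ^ k)"
      using that(2) by (simp add: sum.reindex)
    also have "\<dots> \<le> (\<Sum>k. (1 / 2) ^ k)"
      using that(1) by (intro sum_le_suminf summable_geometric) auto
    also have "\<dots> = 2" by (subst suminf_geometric) auto
    finally show ?thesis .
  qed
  have gram: "sqrt (2 * 4 ^ n) * sqrt (2 * 4 ^ m) / (4 ^ n + 4 ^ m) \<le> 2 * (1 / 2 :: real) ^ (m - n)"
    if le: "n \<le> m" for n m :: nat
  proof -
    have sqrt4: "sqrt (4 ^ k) = 2 ^ k" for k
      by (simp add: real_sqrt_power)
    obtain k where m: "m = n + k" using le_Suc_ex[OF le] by blast
    have "sqrt (2 * 4 ^ n) * sqrt (2 * 4 ^ m) / (4 ^ n + 4 ^ m) = 2 * (2 ^ n * 2 ^ m) / (4 ^ n + 4 ^ m)"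
      by (simp add: real_sqrt_mult sqrt4)
    also have "\<dots> \<le> 2 * (2 ^ n * 2 ^ m) / (4 ^ m :: real)"
      by (intro divide_left_mono) (auto intro!: mult_pos_pos add_pos_pos)
    also have "\<dots> = 2 * (1 / 2) ^ k"
    proof -
      have "(4 :: real) ^ m = 2 ^ m * 2 ^ m" by (simp flip: power_mult_distrib)
      then show ?thesis by (simp add: m power_add power_divide)
    qed
    finally show ?thesis by (simp add: m)
  qed
  \<comment> \<open>Splitting at \<open>n\<close> makes the exponents distinct on each side, so each
    side is at most twice a geometric series of sum 2.\<close>
  have row: "(\<Sum>m\<in>I. sqrt (2 * 4 ^ n) * sqrt (2 * 4 ^ m) / (4 ^ n + 4 ^ m)) \<le> (8 :: real)" for n
  proof -
    let ?g = "\<lambda>m. sqrt (2 * 4 ^ n) * sqrt (2 * 4 ^ m) / (4 ^ n + 4 ^ m) :: real"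
    let ?A = "{m\<in>I. n \<le> m}" and ?B = "{m\<in>I. \<not> n \<le> m}"
    have "(\<Sum>m\<in>?A. ?g m) \<le> (\<Sum>m\<in>?A. 2 * (1 / 2) ^ (m - n))"
      by (intro sum_mono gram) auto
    also have "\<dots> \<le> 2 * 2"
      unfolding sum_distrib_left[symmetric] using I
      by (intro mult_left_mono half) (auto simp: inj_on_def)
    finally have A: "(\<Sum>m\<in>?A. ?g m) \<le> 4" by simp
    have "(\<Sum>m\<in>?B. ?g m) \<le> (\<Sum>m\<in>?B. 2 * (1 / 2) ^ (n - m))"
    proof (rule sum_mono)
      fix m assume "m \<in> ?B"
      then show "?g m \<le> 2 * (1 / 2) ^ (n - m)"
        using gram[of m n] by (simp add: mult.commute add.commute)
    qed
    also have "\<dots> \<le> 2 * 2"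
      unfolding sum_distrib_left[symmetric] using I
      by (intro mult_left_mono half) (auto simp: inj_on_def)
    finally have B: "(\<Sum>m\<in>?B. ?g m) \<le> 4" by simp
    have "(\<Sum>m\<in>I. ?g m) = (\<Sum>m\<in>?A. ?g m) + (\<Sum>m\<in>?B. ?g m)"
      using I by (subst sum.union_disjoint[symmetric]) (auto intro!: sum.cong)
    then show ?thesis using A B by linarith
  qed
  have "(norm (\<Sum>n\<in>I. lacunary_kernel n))\<^sup>2
      \<le> (\<Sum>n\<in>I. \<Sum>m\<in>I. sqrt (2 * 4 ^ n) * sqrt (2 * 4 ^ m) / (4 ^ n + 4 ^ m))"
    unfolding lacunary_kernel_def by (intro norm_sum_hardy_kernel_le I) auto
  also have "\<dots> \<le> (\<Sum>n\<in>I. 8)" by (intro sum_mono row)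
  finally show ?thesis by simp
qed

text \<open>If the images had a nonzero limit point, sums of \<open>N\<close> of them would grow linearly in \<open>N\<close>,
  whereas the sums of the kernels only grow like \<open>sqrt N\<close>.\<close>

lemma compact_operator_lacunary_kernel:
  assumes K: "compact_operator K"
  obtains r :: "nat \<Rightarrow> nat" where "strict_mono r" "(\<lambda>n. K (lacunary_kernel (r n))) \<longlonglongrightarrow> 0"
proof -
  have lin: "bounded_linear K" and comp: "compact (closure (K ` cball 0 1))"
    using K by (auto simp: compact_operator_def bounded_operator_def)
  have "\<forall>n. K (lacunary_kernel n) \<in> closure (K ` cball 0 1)"
    using norm_lacunary_kernel_le closure_subset by (fastforce simp: dist_norm)
  with comp obtain l r where r: "strict_mono r" and lim: "((\<lambda>n. K (lacunary_kernel n)) \<circ> r) \<longlonglongrightarrow> l"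
    unfolding compact_def by metis
  have "l = 0"
  proof (rule ccontr)
    assume "l \<noteq> 0"
    then have l: "norm l > 0" by simp
    then obtain n0 where "\<forall>n\<ge>n0. norm (((\<lambda>n. K (lacunary_kernel n)) \<circ> r) n - l) < norm l / 2"
      using LIMSEQ_D[OF lim half_gt_zero] by blast
    then have n0: "\<And>n. n \<ge> n0 \<Longrightarrow> norm (K (lacunary_kernel (r n)) - l) < norm l / 2"
      by simp
    \<comment> \<open>\<open>N\<close> images within \<open>norm l / 2\<close> of \<open>l\<close>
      have a sum of norm at least \<open>N * norm l / 2\<close>. Squaring and comparing with the
      bound \<open>8 * N\<close> for the kernels gives \<open>32 = 4 * 8\<close>.\<close>
    have growth: "real N * (norm l)\<^sup>2 \<le> 32 * (onorm K)\<^sup>2" if N: "N > 0" for N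
    proof -
      let ?J = "{n0..<n0 + N}"
      let ?s = "\<Sum>n\<in>?J. K (lacunary_kernel (r n))"
      have inj: "inj_on r ?J" using r strict_mono_imp_inj_on by blast
      have "norm (?s - (\<Sum>n\<in>?J. l)) \<le> (\<Sum>n\<in>?J. norm l / 2)"
        unfolding sum_subtractf[symmetric] using n0 by (intro sum_norm_le) (simp add: less_imp_le)
      then have "norm (?s - real N *\<^sub>R l) \<le> real N * (norm l / 2)"
        by (simp add: sum_constant_scaleR)
      moreover have "norm (real N *\<^sub>R l) \<le> norm ?s + norm (?s - real N *\<^sub>R l)"
        using norm_triangle_ineq4[of ?s "?s - real N *\<^sub>R l"] by simp
      ultimately have "real N * (norm l / 2) \<le> norm ?s" by simp
      moreover have "?s = K (\<Sum>n\<in>r ` ?J. lacunary_kernel n)"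
        using inj by (simp add: linear_sum[OF bounded_linear.linear[OF lin]] sum.reindex)
      then have "norm ?s \<le> onorm K * norm (\<Sum>n\<in>r ` ?J. lacunary_kernel n)"
        using onorm[OF lin] by simp
      ultimately have "(real N * (norm l / 2))\<^sup>2 \<le> (onorm K * norm (\<Sum>n\<in>r ` ?J. lacunary_kernel n))\<^sup>2"
        by (intro power_mono) auto
      also have "\<dots> \<le> (onorm K)\<^sup>2 * (8 * real N)"
        unfolding power_mult_distrib
        using norm_sum_lacunary_kernel_le[of "r ` ?J"] card_image[OF inj]
        by (intro mult_left_mono) auto
      finally have "real N * (real N * (norm l)\<^sup>2) \<le> real N * (32 * (onorm K)\<^sup>2)"
        by (simp add: power2_eq_square algebra_simps)
      then show ?thesis using N by simp
    qed
    obtain N where "real N > 32 * (onorm K)\<^sup>2 / (norm l)\<^sup>2"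
      using reals_Archimedean2 by blast
    then have "real (Suc N) * (norm l)\<^sup>2 > 32 * (onorm K)\<^sup>2"
      using l by (simp add: field_simps add_strict_increasing)
    with growth[of "Suc N"] show False by simp
  qed
  with r lim show ?thesis by (intro that) (auto simp: o_def)
qed

section \<open>Norm and essential norm\<close>

text \<open>The image of the kernel at \<open>\<phi> w\<close> takes at \<open>w\<close> the value
  \<open>1 / (2 * Re (\<phi> w))\<close>, and \<open>H2_pointwise\<close> bounds it by the norm of
  that image. This is what makes the infimum \<open>c\<close> positive.\<close>

lemma composition_kernel_bound:
  assumes maps: "\<phi> ` half_plane \<subseteq> half_plane" and bc: "bounded_composition \<phi>" and w: "w \<in> half_plane"
  shows "Re w \<le> (onorm (composition_operator \<phi>))\<^sup>2 * Re (\<phi> w)"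
proof -
  let ?T = "composition_operator \<phi>" and ?k = "hardy_kernel (\<phi> w)"
  have lin: "bounded_linear ?T" using bc by (auto simp: bounded_composition_def bounded_operator_def)
  have pos: "Re w > 0" "Re (\<phi> w) > 0" "\<phi> w \<in> half_plane"
    using maps w by (auto simp: half_plane_def)
  have sum: "\<phi> w + cnj (\<phi> w) = of_real (2 * Re (\<phi> w))" by (simp add: complex_eq_iff)
  have "Rep_H2 (?T ?k) w = 1 / of_real (2 * Re (\<phi> w))"
    using pos w by (simp only: Rep_composition_operator[OF bc] compose_H2_def Rep_hardy_kernel if_True sum)
  then have "(1 / (2 * Re (\<phi> w)))\<^sup>2 = (cmod (Rep_H2 (?T ?k) w))\<^sup>2"
    using pos by (simp add: norm_divide)
  also have "\<dots> \<le> (norm (?T ?k))\<^sup>2 / (2 * Re w)"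
    using pos by (intro H2_pointwise)
  also have "\<dots> \<le> (onorm ?T * sqrt (1 / (2 * Re (\<phi> w))))\<^sup>2 / (2 * Re w)"
  proof (intro divide_right_mono power_mono)
    have "norm (?T ?k) \<le> onorm ?T * norm ?k" by (rule onorm[OF lin])
    also have "\<dots> \<le> onorm ?T * sqrt (1 / (2 * Re (\<phi> w)))"
      using pos by (intro mult_left_mono norm_hardy_kernel_le onorm_pos_le lin)
    finally show "norm (?T ?k) \<le> onorm ?T * sqrt (1 / (2 * Re (\<phi> w)))" .
  qed (use pos in auto)
  also have "\<dots> = (onorm ?T)\<^sup>2 * (1 / (2 * Re (\<phi> w))) / (2 * Re w)"
    using pos by (simp add: power_mult_distrib)
  finally show ?thesis
    using pos by (simp add: field_simps power2_eq_square)
qed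

text \<open>The image is evaluated at \<open>4 ^ n / c\<close> and \<open>H2_pointwise\<close> is
  read backwards. The second factor tends to 1 when
  \<open>\<phi> (of_real (4 ^ n / c)) / of_real (4 ^ n)\<close> does.\<close>

lemma norm_composition_lacunary_ge:
  assumes maps: "\<phi> ` half_plane \<subseteq> half_plane" and bc: "bounded_composition \<phi>" and c: "c > 0"
  shows "sqrt (1 / c) * (2 / cmod (\<phi> (of_real (4 ^ n / c)) / of_real (4 ^ n) + 1))
    \<le> norm (composition_operator \<phi> (lacunary_kernel n))"
proof -
  define a :: real where "a = 4 ^ n"
  define v where "v = \<phi> (of_real (a / c))"
  let ?Tf = "composition_operator \<phi> (lacunary_kernel n)"
  have a: "a > 0" by (simp add: a_def)
  have x: "of_real (a / c) \<in> half_plane" using a c by (simp add: half_plane_def)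
  then have v: "v \<in> half_plane" using maps by (auto simp: v_def)
  have "Rep_H2 ?Tf (of_real (a / c)) = of_real (sqrt (2 * a)) * (1 / (v + of_real a))"
    using x v a unfolding Rep_composition_operator[OF bc] compose_H2_def lacunary_kernel_def
      scaleR_H2.rep_eq a_def[symmetric] v_def[symmetric] by (simp add: Rep_hardy_kernel)
  then have "(cmod (Rep_H2 ?Tf (of_real (a / c))))\<^sup>2 = 2 * a / (cmod (v + of_real a))\<^sup>2"
    using a by (simp add: norm_mult norm_divide power_mult_distrib power_divide)
  moreover have "(cmod (Rep_H2 ?Tf (of_real (a / c))))\<^sup>2 \<le> (norm ?Tf)\<^sup>2 / (2 * (a / c))"
    using H2_pointwise[of "of_real (a / c)" ?Tf] a c by simp
  ultimately have "2 * a / (cmod (v + of_real a))\<^sup>2 * (2 * (a / c)) \<le> (norm ?Tf)\<^sup>2"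
    using a c by (subst (asm) le_divide_eq) auto
  moreover have "v / of_real a + 1 = (v + of_real a) / of_real a"
    using a by (simp add: field_simps)
  then have "(sqrt (1 / c) * (2 / cmod (v / of_real a + 1)))\<^sup>2 = 2 * a / (cmod (v + of_real a))\<^sup>2 * (2 * (a / c))"
    using a c by (simp add: norm_divide power_mult_distrib power_divide) (simp add: power2_eq_square)
  ultimately have "(sqrt (1 / c) * (2 / cmod (v / of_real a + 1)))\<^sup>2 \<le> (norm ?Tf)\<^sup>2"
    by simp
  then show ?thesis
    unfolding v_def a_def by (rule power2_le_imp_le) simp
qed

text \<open>The value \<open>sqrt (1 / c)\<close> separates the two sides. Treating each
  \<open>K\<close> by itself also allows the choice of \<open>K\<close> as the composition
  operator.\<close>

lemma onorm_composition_operator_le: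
  assumes hol: "\<phi> holomorphic_on half_plane" and maps: "\<phi> ` half_plane \<subseteq> half_plane"
    and bc: "bounded_composition \<phi>" and K: "compact_operator K"
  shows "onorm (composition_operator \<phi>) \<le> onorm (\<lambda>f. composition_operator \<phi> f - K f)"
proof -
  let ?T = "composition_operator \<phi>"
  have lin: "bounded_linear ?T" using bc by (auto simp: bounded_composition_def bounded_operator_def)
  have linK: "bounded_linear K" using K by (auto simp: compact_operator_def bounded_operator_def)
  define q where "q = (\<lambda>z. Re (\<phi> z) / Re z)"
  define c where "c = (INF z\<in>half_plane. q z)"
  have pos: "Re z > 0" "Re (\<phi> z) > 0" if "z \<in> half_plane" for z
    using that maps by (auto simp: half_plane_def)
  have one: "1 \<in> half_plane" by (simp add: half_plane_def)
  have kb: "Re z \<le> (onorm ?T)\<^sup>2 * Re (\<phi> z)" if "z \<in> half_plane" for z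
    by (rule composition_kernel_bound[OF maps bc that])
  have "(onorm ?T)\<^sup>2 \<noteq> 0" using kb[OF one] by auto
  then have N: "(onorm ?T)\<^sup>2 > 0" by simp
  have "1 / (onorm ?T)\<^sup>2 \<le> q z" if "z \<in> half_plane" for z
    using kb[OF that] pos[OF that] N by (simp add: q_def divide_simps mult.commute)
  then have "1 / (onorm ?T)\<^sup>2 \<le> c"
    unfolding c_def using one by (intro cINF_greatest) auto
  moreover have "1 / (onorm ?T)\<^sup>2 > 0" using N by simp
  ultimately have c: "c > 0" by linarith
  have bdd: "bdd_below (q ` half_plane)"
    using pos by (intro bdd_belowI[of _ 0]) (auto simp: q_def less_imp_le)
  have ge: "c * Re z \<le> Re (\<phi> z)" if "z \<in> half_plane" for z
  proof -
    have "c \<le> q z" unfolding c_def by (rule cINF_lower[OF bdd that])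
    then show ?thesis using pos(1)[OF that] by (simp add: q_def pos_le_divide_eq)
  qed
  have "\<exists>z\<in>half_plane. Re (\<phi> z) \<le> (c + e) * Re z" if e: "e > 0" for e
  proof -
    have "(INF z\<in>half_plane. q z) < c + e" using e by (simp add: c_def)
    then obtain z where z: "z \<in> half_plane" "q z < c + e"
      using cINF_less_iff[OF _ bdd] one by blast
    then have "Re (\<phi> z) \<le> (c + e) * Re z"
      using pos(1)[OF z(1)] by (simp add: q_def pos_divide_less_eq less_imp_le)
    with z(1) show ?thesis by blast
  qed
  with hol ge have ang: "((\<lambda>x. \<phi> (of_real x) / of_real x) \<longlongrightarrow> of_real c) at_top"
    by (rule angular_derivative_at_infinity)
  obtain r where r: "strict_mono r" and Kr: "(\<lambda>n. K (lacunary_kernel (r n))) \<longlonglongrightarrow> 0"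
    using compact_operator_lacunary_kernel[OF K] by blast
  define b where "b = (\<lambda>n. sqrt (1 / c) * (2 / cmod (\<phi> (of_real (4 ^ n / c)) / of_real (4 ^ n) + 1)))"
  have "b \<longlonglongrightarrow> sqrt (1 / c)"
  proof -
    have "filterlim (\<lambda>n. 4 ^ n / c :: real) at_top sequentially"
      using c by real_asymp
    then have "(\<lambda>n. \<phi> (of_real (4 ^ n / c)) / of_real (4 ^ n / c)) \<longlonglongrightarrow> of_real c"
      by (rule filterlim_compose[OF ang])
    \<comment> \<open>Dividing by \<open>4 ^ n / c\<close> and then by \<open>c\<close> is dividing
      by \<open>4 ^ n\<close>, so the quotient in \<open>b\<close> tends to
      \<open>c / c = 1\<close>.\<close>
    then have "(\<lambda>n. sqrt (1 / c) * (2 / cmod (\<phi> (of_real (4 ^ n / c)) / of_real (4 ^ n / c) / of_real c + 1)))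
        \<longlonglongrightarrow> sqrt (1 / c) * (2 / cmod (of_real c / of_real c + 1))"
      using c by (intro tendsto_mult tendsto_divide tendsto_norm tendsto_add tendsto_const) auto
    then show ?thesis using c by (simp add: b_def)
  qed
  then have "(b \<circ> r) \<longlonglongrightarrow> sqrt (1 / c)"
    using r by (rule LIMSEQ_subseq_LIMSEQ)
  then have "(\<lambda>n. b (r n) - norm (K (lacunary_kernel (r n)))) \<longlonglongrightarrow> sqrt (1 / c) - norm (0 :: H2)"
    using Kr by (intro tendsto_diff tendsto_norm) (simp_all add: o_def)
  then have "sqrt (1 / c) - norm (0 :: H2) \<le> onorm (\<lambda>f. ?T f - K f)"
  proof (rule LIMSEQ_le_const2, intro exI allI impI)
    fix n
    let ?u = "lacunary_kernel (r n)"
    have diff: "bounded_linear (\<lambda>f. ?T f - K f)" by (rule bounded_linear_sub[OF lin linK])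
    have "b (r n) - norm (K ?u) \<le> norm (?T ?u) - norm (K ?u)"
      using norm_composition_lacunary_ge[OF maps bc c] by (simp add: b_def)
    also have "\<dots> \<le> norm (?T ?u - K ?u)" by (rule norm_triangle_ineq2)
    also have "\<dots> \<le> onorm (\<lambda>f. ?T f - K f) * norm ?u" by (rule onorm[OF diff])
    also have "\<dots> \<le> onorm (\<lambda>f. ?T f - K f) * 1"
      by (intro mult_left_mono norm_lacunary_kernel_le onorm_pos_le diff)
    finally show "b (r n) - norm (K ?u) \<le> onorm (\<lambda>f. ?T f - K f)" by simp
  qed
  moreover have "onorm ?T \<le> sqrt (1 / c)"
  proof (rule onorm_bound)
    show "norm (?T f) \<le> sqrt (1 / c) * norm f" for f
      using hol bc c ge by (rule norm_composition_operator_le)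
  qed (use c in simp)
  ultimately show ?thesis by simp
qed

text \<open>A real infimum is meaningful only for a nonempty family bounded below;
  \<open>compact_operator_zero\<close> gives the other half.\<close>

lemma essential_norm_bdd_below:
  assumes "bounded_linear T"
  shows "bdd_below ((\<lambda>K. onorm (\<lambda>f. T f - K f)) ` {K. compact_operator K})"
  by (rule bdd_belowI[of _ 0])
    (auto intro!: onorm_pos_le bounded_linear_sub assms simp: compact_operator_def bounded_operator_def)

lemma compact_operator_zero: "compact_operator (\<lambda>f. 0)"
proof -
  have "scaleC_H2 c 0 = 0" for c by transfer simp
  moreover have "(\<lambda>f. 0 :: H2) ` cball (0 :: H2) 1 = {0}" by (auto simp: image_constant_conv)
  ultimately show ?thesis
    by (simp add: compact_operator_def bounded_operator_def bounded_linear_zero)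
qed

lemma onorm_eq_essential_norm:
  assumes "\<phi> holomorphic_on half_plane" "\<phi> ` half_plane \<subseteq> half_plane" and bc: "bounded_composition \<phi>"
  shows "onorm (composition_operator \<phi>) = essential_norm (composition_operator \<phi>)"
proof (rule antisym)
  show "onorm (composition_operator \<phi>) \<le> essential_norm (composition_operator \<phi>)"
    unfolding essential_norm_def using compact_operator_zero
    by (intro cINF_greatest) (auto intro!: onorm_composition_operator_le[OF assms])
  have "bounded_linear (composition_operator \<phi>)"
    using bc by (auto simp: bounded_composition_def bounded_operator_def)
  from cINF_lower[OF essential_norm_bdd_below[OF this], of "\<lambda>f. 0"] compact_operator_zero
  show "essential_norm (composition_operator \<phi>) \<le> onorm (composition_operator \<phi>)"
    unfolding essential_norm_def by simp
qed

theorem corollary3p3: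
  shows "(\<forall>\<phi>. \<phi> holomorphic_on half_plane \<and> \<phi> ` half_plane \<subseteq> half_plane \<and> bounded_composition \<phi> \<longrightarrow>
            onorm (composition_operator \<phi>) = essential_norm (composition_operator \<phi>)) \<and>
         \<not> (\<exists>\<phi>. \<phi> holomorphic_on half_plane \<and> \<phi> ` half_plane \<subseteq> half_plane \<and> bounded_composition \<phi> \<and>
            compact_operator (composition_operator \<phi>) \<and> composition_operator \<phi> \<noteq> (\<lambda>f. 0))"
proof (intro conjI allI impI notI)
  fix \<phi> assume "\<phi> holomorphic_on half_plane \<and> \<phi> ` half_plane \<subseteq> half_plane \<and> bounded_composition \<phi>"
  then show "onorm (composition_operator \<phi>) = essential_norm (composition_operator \<phi>)"
    by (auto intro: onorm_eq_essential_norm)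
next
  assume "\<exists>\<phi>. \<phi> holomorphic_on half_plane \<and> \<phi> ` half_plane \<subseteq> half_plane \<and> bounded_composition \<phi> \<and>
            compact_operator (composition_operator \<phi>) \<and> composition_operator \<phi> \<noteq> (\<lambda>f. 0)"
  then obtain \<phi> where \<phi>: "\<phi> holomorphic_on half_plane" "\<phi> ` half_plane \<subseteq> half_plane" "bounded_composition \<phi>"
      "compact_operator (composition_operator \<phi>)" and nz: "composition_operator \<phi> \<noteq> (\<lambda>f. 0)"
    by blast
  have lin: "bounded_linear (composition_operator \<phi>)"
    using \<phi>(3) by (auto simp: bounded_composition_def bounded_operator_def)
  have "onorm (composition_operator \<phi>) \<le> 0"
    \<comment> \<open>Taking \<open>K\<close> to be the composition operator makes the right-hand
      side the norm of the zero map.\<close>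
    using onorm_composition_operator_le[OF \<phi>] by (simp add: onorm_zero)
  then have "onorm (composition_operator \<phi>) = 0"
    using onorm_pos_le[OF lin] by simp
  then show False using onorm_eq_0[OF lin] nz by auto
qed

end
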